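(* Let $n\ge 2$ be an integer and let $\mathcal{E}_n$ be the generating graph of $\mathbb{Z}_n$. Then: 1. $\mathcal{E}_n$ is connected, with diameter $2$ if $n$ is not prime and diameter $1$ if $n$ is prime. 2. $\mathcal{E}_n$ is regular if and only if $n$ is prime. 3. $\mathcal{E}_n$ is bipartite only for $n=2$ (i.e. if and only if $n=2$). 4. $\mathcal{E}_n$ is Hamiltonian for $n>2$. 5. $\mathcal{E}_n$ is Eulerian if and only if $n$ is odd. 6. $\mathcal{E}_n$ is planar only for $n=2,3,4,6$ (i.e. if and only if $n\in\{2,3,4,6\}$). 7. The chromatic number and the clique number of $\mathcal{E}_n$ are both equal to $\varphi(n)+\omega(n)$. 8. The independence number of $\mathcal{E}_n$ is $\frac{n}{p_1}$, where $p_1$ is the smallest prime divisor of $n$.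
   Context: $\mathbb{Z}_n=\{0,1,\dots,n-1\}$ is the additive group of integers modulo $n$. The generating graph $\mathcal{E}_n$ is the simple graph with vertex set $\mathbb{Z}_n$ in which two distinct vertices $a,b$ are adjacent if and only if $\langle a,b\rangle=\mathbb{Z}_n$, equivalently $\gcd(a,b,n)=1$. $\varphi$ is Euler's totient function and $\omega(n)$ is the number of distinct prime divisors of $n$. *)

theory Defs
  imports
    "HOL-Analysis.Analysis"
    "HOL-Algebra.Elementary_Groups"
    "HOL-Number_Theory.Totient"
begin

text \<open>
  Undirected simple graphs, given by a vertex set and a set of two-element sets of vertices.
  The notions below are meant for finite graphs with at least one vertex: then all the minima
  and maxima involved are attained.
\<close>

record 'a sgraph =
  verts :: "'a set"
  edges :: "'a set set"

definition adjacent :: "'a sgraph \<Rightarrow> 'a \<Rightarrow> 'a \<Rightarrow> bool" where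
  "adjacent G u v \<longleftrightarrow> {u, v} \<in> edges G"

definition vertex_degree :: "'a sgraph \<Rightarrow> 'a \<Rightarrow> nat" where
  "vertex_degree G v = card {e \<in> edges G. v \<in> e}"

definition regular_graph :: "'a sgraph \<Rightarrow> bool" where
  "regular_graph G \<longleftrightarrow> (\<exists>k. \<forall>v\<in>verts G. vertex_degree G v = k)"

text \<open>A walk is the nonempty list of its vertices; its length is the number of its edges.\<close>

definition walk_edges :: "'a list \<Rightarrow> 'a set list" where
  "walk_edges vs = map (\<lambda>(u, v). {u, v}) (zip vs (tl vs))"

definition is_walk :: "'a sgraph \<Rightarrow> 'a list \<Rightarrow> bool" where
  "is_walk G vs \<longleftrightarrow> vs \<noteq> [] \<and> set vs \<subseteq> verts G \<and> set (walk_edges vs) \<subseteq> edges G"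

definition walk_between :: "'a sgraph \<Rightarrow> 'a \<Rightarrow> 'a \<Rightarrow> 'a list \<Rightarrow> bool" where
  "walk_between G u v vs \<longleftrightarrow> is_walk G vs \<and> hd vs = u \<and> last vs = v"

definition connected_graph :: "'a sgraph \<Rightarrow> bool" where
  "connected_graph G \<longleftrightarrow>
     verts G \<noteq> {} \<and> (\<forall>u\<in>verts G. \<forall>v\<in>verts G. \<exists>vs. walk_between G u v vs)"

text \<open>Vertices that are not joined by a walk have distance \<open>\<infinity>\<close>.\<close>

definition graph_distance :: "'a sgraph \<Rightarrow> 'a \<Rightarrow> 'a \<Rightarrow> enat" where
  "graph_distance G u v = Inf {enat (length (walk_edges vs)) | vs. walk_between G u v vs}"

definition diameter_of_graph :: "'a sgraph \<Rightarrow> enat" where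
  "diameter_of_graph G = Sup {graph_distance G u v | u v. u \<in> verts G \<and> v \<in> verts G}"

definition bipartite_graph :: "'a sgraph \<Rightarrow> bool" where
  "bipartite_graph G \<longleftrightarrow>
     (\<exists>A B. A \<union> B = verts G \<and> A \<inter> B = {} \<and> (\<forall>e\<in>edges G. \<exists>a\<in>A. \<exists>b\<in>B. e = {a, b}))"

text \<open>
  A Hamiltonian cycle lists every vertex exactly once; as a cycle of a simple graph it has length
  at least three. In particular, the complete graph on two vertices is not Hamiltonian.
\<close>

definition hamiltonian_graph :: "'a sgraph \<Rightarrow> bool" where
  "hamiltonian_graph G \<longleftrightarrow>
     (\<exists>vs. is_walk G vs \<and> distinct vs \<and> set vs = verts G \<and> 3 \<le> length vs \<and>
           adjacent G (last vs) (hd vs))"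

definition eulerian_graph :: "'a sgraph \<Rightarrow> bool" where
  "eulerian_graph G \<longleftrightarrow>
     (\<exists>vs. is_walk G vs \<and> hd vs = last vs \<and> distinct (walk_edges vs) \<and>
           set (walk_edges vs) = edges G)"

text \<open>
  A plane drawing places the vertices at distinct points and represents each edge by an arc joining
  the points of its endpoints. An arc passes through no other vertex point, and two different arcs
  meet only in the points of the common endpoints of their edges.
\<close>

definition plane_drawing :: "'a sgraph \<Rightarrow> ('a \<Rightarrow> complex) \<Rightarrow> ('a set \<Rightarrow> real \<Rightarrow> complex) \<Rightarrow> bool" where
  "plane_drawing G p \<gamma> \<longleftrightarrow>
     inj_on p (verts G) \<and>
     (\<forall>e\<in>edges G. arc (\<gamma> e) \<and> {pathstart (\<gamma> e), pathfinish (\<gamma> e)} = p ` e) \<and>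
     (\<forall>e\<in>edges G. path_image (\<gamma> e) \<inter> p ` verts G = p ` e) \<and>
     (\<forall>e\<in>edges G. \<forall>f\<in>edges G. e \<noteq> f \<longrightarrow>
        path_image (\<gamma> e) \<inter> path_image (\<gamma> f) = p ` (e \<inter> f))"

definition planar_graph :: "'a sgraph \<Rightarrow> bool" where
  "planar_graph G \<longleftrightarrow> (\<exists>p \<gamma>. plane_drawing G p \<gamma>)"

definition proper_colouring :: "'a sgraph \<Rightarrow> nat \<Rightarrow> ('a \<Rightarrow> nat) \<Rightarrow> bool" where
  "proper_colouring G k c \<longleftrightarrow>
     c ` verts G \<subseteq> {..<k} \<and>
     (\<forall>u\<in>verts G. \<forall>v\<in>verts G. adjacent G u v \<longrightarrow> c u \<noteq> c v)"

definition chromatic_number :: "'a sgraph \<Rightarrow> nat" where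
  "chromatic_number G = (LEAST k. \<exists>c. proper_colouring G k c)"

definition is_clique :: "'a sgraph \<Rightarrow> 'a set \<Rightarrow> bool" where
  "is_clique G S \<longleftrightarrow>
     S \<subseteq> verts G \<and> (\<forall>u\<in>S. \<forall>v\<in>S. u \<noteq> v \<longrightarrow> adjacent G u v)"

definition clique_number :: "'a sgraph \<Rightarrow> nat" where
  "clique_number G = Max {card S | S. is_clique G S}"

definition is_independent :: "'a sgraph \<Rightarrow> 'a set \<Rightarrow> bool" where
  "is_independent G S \<longleftrightarrow>
     S \<subseteq> verts G \<and> (\<forall>u\<in>S. \<forall>v\<in>S. u \<noteq> v \<longrightarrow> \<not> adjacent G u v)"

definition independence_number :: "'a sgraph \<Rightarrow> nat" where
  "independence_number G = Max {card S | S. is_independent G S}"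

definition generating_graph :: "('a, 'b) monoid_scheme \<Rightarrow> 'a sgraph" where
  "generating_graph G =
     \<lparr>verts = carrier G,
      edges = {{a, b} | a b. a \<in> carrier G \<and> b \<in> carrier G \<and> a \<noteq> b \<and>
                             generate G {a, b} = carrier G}\<rparr>"

text \<open>
  For \<open>n > 0\<close>, \<open>integer_mod_group n\<close> is the group of the integers \<open>0, \<dots>, n - 1\<close> under addition
  modulo \<open>n\<close>.
\<close>

definition zmod_generating_graph :: "nat \<Rightarrow> int sgraph" where
  "zmod_generating_graph n = generating_graph (integer_mod_group n)"

definition prime_omega :: "nat \<Rightarrow> nat" where
  "prime_omega n = card (prime_factors n)"

end

theory Submission
  imports Defs
begin

text \<open>
  Two vertices \<open>a\<close> and \<open>b\<close> are adjacent iff no prime divisor of \<open>n\<close> divides both. So every unit is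
  adjacent to all other vertices, and \<open>0\<close> only to the units, which settles distances, regularity
  and bipartiteness; \<open>0, 1, \<dots>, n - 1\<close> is a Hamiltonian cycle. For odd \<open>n\<close> and a non-unit \<open>v\<close> the
  neighbourhood of \<open>v\<close> is invariant under the fixed-point-free involution \<open>b \<mapsto> n - b\<close>, so all
  degrees are even. The units together with the prime divisors modulo \<open>n\<close> form a clique, and sending
  each non-unit to a common prime divisor of it and \<open>n\<close> is a colouring by that clique. Any \<open>p\<^sub>1\<close>
  consecutive numbers form a clique, so an independent set meets each of the \<open>n div p\<^sub>1\<close> blocks at
  most once.

  If \<open>n\<close> is not \<open>2\<close>, \<open>3\<close>, \<open>4\<close> or \<open>6\<close>, there is a unit \<open>u\<close> with \<open>1 < u < n/2\<close>, and \<open>0, 1, u, n - u, n - 1\<close> are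
  pairwise adjacent. In a drawing of the complete graph on five vertices \<open>a, b, c, d, e\<close>, an inversion at
  a point inside the triangle \<open>abc\<close> allows us to assume that \<open>d\<close> lies inside it. The arcs from \<open>d\<close> then split
  the inside into the insides of three smaller triangles; \<open>e\<close> lies in one of them, hence is
  separated from the opposite corner.
\<close>

section \<open>Five mutually adjacent vertices cannot be drawn in the plane\<close>

text \<open>Forgetting the parametrization makes an arc reversible and lets all incidences of a
  drawing be stated as intersections of sets.\<close>

definition arc_between :: "complex set \<Rightarrow> complex \<Rightarrow> complex \<Rightarrow> bool" where
  "arc_between S a b \<longleftrightarrow>
     (\<exists>c. arc c \<and> pathstart c = a \<and> pathfinish c = b \<and> path_image c = S)"

lemma arc_between_sym: "arc_between S a b \<Longrightarrow> arc_between S b a"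
  unfolding arc_between_def
  by (metis arc_reversepath path_image_reversepath pathfinish_reversepath pathstart_reversepath)

lemma arc_between_distinct: "arc_between S a b \<Longrightarrow> a \<noteq> b"
  unfolding arc_between_def using arc_distinct_ends by blast

lemma arc_between_ends: "arc_between S a b \<Longrightarrow> a \<in> S \<and> b \<in> S"
  unfolding arc_between_def by auto

lemma arc_between_compact: "arc_between S a b \<Longrightarrow> compact S"
  unfolding arc_between_def using compact_arc_image by blast

lemma arc_between_connected: "arc_between S a b \<Longrightarrow> connected S"
  unfolding arc_between_def using connected_arc_image by blast

lemma arc_between_interior_nonempty: "arc_between S a b \<Longrightarrow> S - {a, b} \<noteq> {}"
  unfolding arc_between_def using nonempty_simple_path_endless arc_imp_simple_path by blast

text \<open>By injectivity the remaining set is the image of the half-open interval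
  \<open>{0..<1}\<close>. This is for arcs that touch a closed curve in an endpoint only.\<close>

lemma arc_between_connected_remove_end:
  assumes "arc_between S a b"
  shows "connected (S - {b})"
proof -
  obtain c where c: "arc c" "pathstart c = a" "pathfinish c = b" "path_image c = S"
    using assms unfolding arc_between_def by blast
  have inj: "inj_on c {0..1}" and cont: "continuous_on {0..1} c"
    using c(1) by (auto simp: arc_def path_def)
  have "S - {b} = c ` ({0..1} - {1})"
    using inj c(3,4) by (subst inj_on_image_set_diff[of _ "{0..1}"])
      (auto simp: path_image_def pathfinish_def)
  also have "{0..1} - {1} = {0..<1::real}" by auto
  finally have eq: "S - {b} = c ` {0..<1}" .
  have "continuous_on {0..<1} c" using cont by (rule continuous_on_subset) auto
  then show ?thesis unfolding eq by (intro connected_continuous_image) auto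
qed

lemma arc_between_join:
  assumes "arc_between S a b" "arc_between T b c" "S \<inter> T = {b}"
  shows "arc_between (S \<union> T) a c"
proof -
  obtain g h where g: "arc g" "pathstart g = a" "pathfinish g = b" "path_image g = S"
    and h: "arc h" "pathstart h = b" "pathfinish h = c" "path_image h = T"
    using assms unfolding arc_between_def by blast
  have "arc (g +++ h)" using g h assms(3) by (intro arc_join) auto
  moreover have "path_image (g +++ h) = S \<union> T" using g h by (simp add: path_image_join)
  ultimately show ?thesis unfolding arc_between_def
    using g h by (intro exI[of _ "g +++ h"]) auto
qed

text \<open>The two arcs form a simple closed curve, to which the Jordan curve theorem
  applies.\<close>

lemma arc_between_loop_inside_nonempty:
  assumes "arc_between S a b" "arc_between T a b" "S \<inter> T = {a, b}"
  shows "inside (S \<union> T) \<noteq> {}"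
proof -
  obtain g h where g: "arc g" "pathstart g = a" "pathfinish g = b" "path_image g = S"
    and h: "arc h" "pathstart h = b" "pathfinish h = a" "path_image h = T"
    using assms(1) arc_between_sym[OF assms(2)] unfolding arc_between_def by blast
  have "simple_path (g +++ h)" using g h assms(3) by (intro simple_path_join_loop) auto
  moreover have "path_image (g +++ h) = S \<union> T" using g h by (simp add: path_image_join)
  ultimately show ?thesis
    using Jordan_inside_outside[of "g +++ h"] g h by auto
qed

text \<open>The arcs form a theta curve with \<open>R\<close> in the middle; this is
  \<open>split_inside_simple_closed_curve\<close> in the language of point sets.\<close>

lemma theta_inside_split:
  assumes "arc_between P a b" "arc_between Q a b" "arc_between R a b"
    and "P \<inter> Q = {a, b}" "P \<inter> R = {a, b}" "Q \<inter> R = {a, b}"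
    and "R \<inter> inside (P \<union> Q) \<noteq> {}"
  shows "inside (P \<union> R) \<union> inside (Q \<union> R) \<union> (R - {a, b}) = inside (P \<union> Q)"
proof -
  obtain f g h where f: "arc f" "pathstart f = a" "pathfinish f = b" "path_image f = P"
    and g: "arc g" "pathstart g = a" "pathfinish g = b" "path_image g = Q"
    and h: "arc h" "pathstart h = a" "pathfinish h = b" "path_image h = R"
    using assms(1-3) unfolding arc_between_def by blast
  show ?thesis
    by (rule split_inside_simple_closed_curve[of f a b g h])
      (use f g h assms arc_imp_simple_path arc_between_distinct in auto)
qed

text \<open>A connected set that misses \<open>S\<close> stays in one component of the complement,
  and \<open>inside S\<close> is a union of components.\<close>

lemma connected_subset_inside:
  assumes "connected C" "C \<inter> S = {}" "x \<in> C" "x \<in> inside S"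
  shows "C \<subseteq> inside S"
proof
  fix y assume "y \<in> C"
  then have "connected_component (- S) x y"
    unfolding connected_component_def using assms by blast
  then show "y \<in> inside S" using assms(4) inside_same_component by blast
qed

text \<open>Two theta curves are used. The path from \<open>a\<close> over \<open>d\<close> to
  \<open>b\<close> splits the triangle into the triangle \<open>abd\<close> and the quadrilateral
  with corners \<open>a\<close>, \<open>c\<close>, \<open>b\<close>, \<open>d\<close>; then
  \<open>CD\<close> splits the quadrilateral.\<close>

lemma K4_inside_split:
  assumes arcs: "arc_between AB a b" "arc_between AC a c" "arc_between BC b c"
      "arc_between AD a d" "arc_between BD b d" "arc_between CD c d"
    and int: "AB \<inter> AC = {a}" "AB \<inter> BC = {b}" "AC \<inter> BC = {c}"
      "AB \<inter> AD = {a}" "AB \<inter> BD = {b}" "AB \<inter> CD = {}"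
      "AC \<inter> AD = {a}" "AC \<inter> BD = {}" "AC \<inter> CD = {c}"
      "BC \<inter> AD = {}" "BC \<inter> BD = {b}" "BC \<inter> CD = {c}"
      "AD \<inter> BD = {d}" "AD \<inter> CD = {d}" "BD \<inter> CD = {d}"
    and d: "d \<in> inside (AB \<union> AC \<union> BC)"
  shows "inside (AB \<union> AC \<union> BC) =
           inside (AB \<union> AD \<union> BD) \<union> inside (AC \<union> AD \<union> CD) \<union> inside (BC \<union> BD \<union> CD) \<union>
           (AD \<union> BD \<union> CD - {a, b, c})"
proof -
  note ends = arcs[THEN arc_between_ends]
  note dist = arcs[THEN arc_between_distinct]
  note int' = int int[THEN trans[OF Int_commute]]
  have ACB: "arc_between (AC \<union> BC) a b"
    by (rule arc_between_join[OF arcs(2) arc_between_sym[OF arcs(3)] int(3)])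
  have ADB: "arc_between (AD \<union> BD) a b"
    by (rule arc_between_join[OF arcs(4) arc_between_sym[OF arcs(5)] int(13)])
  have CAD: "arc_between (AC \<union> AD) c d"
    by (rule arc_between_join[OF arc_between_sym[OF arcs(2)] arcs(4) int(7)])
  have CBD: "arc_between (BC \<union> BD) c d"
    by (rule arc_between_join[OF arc_between_sym[OF arcs(3)] arcs(5) int(11)])
  define T where "T = AB \<union> (AC \<union> BC)"
  have dT: "d \<in> inside T" using d by (simp add: T_def Un_assoc)
  have T_notin: "T \<inter> inside T = {}" using inside_no_overlap by blast
  have split1: "inside (AB \<union> (AD \<union> BD)) \<union> inside ((AC \<union> BC) \<union> (AD \<union> BD)) \<union> ((AD \<union> BD) - {a, b})
      = inside T" unfolding T_def
  proof (rule theta_inside_split[OF arcs(1) ACB ADB])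
    show "(AD \<union> BD) \<inter> inside (AB \<union> (AC \<union> BC)) \<noteq> {}"
      using dT ends(4) unfolding T_def by blast
  qed (simp_all add: Int_Un_distrib Int_Un_distrib2 int' insert_commute)
  \<comment> \<open>This point will witness that \<open>CD\<close> runs through the inside of the
    quadrilateral, as the second splitting requires.\<close>
  obtain y where y: "y \<in> CD" "y \<noteq> c" "y \<noteq> d"
    using arc_between_interior_nonempty[OF arcs(6)] by blast
  have "CD - {c} \<subseteq> inside T"
  proof (rule connected_subset_inside[OF _ _ _ dT])
    show "connected (CD - {c})"
      by (rule arc_between_connected_remove_end[OF arc_between_sym[OF arcs(6)]])
    show "(CD - {c}) \<inter> T = {}" using int(6,9,12) unfolding T_def by blast
    show "d \<in> CD - {c}" using ends(6) dist(6) by blast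
  qed
  then have y_in: "y \<in> inside T" using y by blast
  have c_notin: "c \<notin> inside T"
    using ends(2) T_notin unfolding T_def by blast
  \<comment> \<open>Otherwise the rest of \<open>CD\<close> would carry \<open>c\<close> into the
    inside of \<open>abd\<close> and hence of \<open>T\<close>, although \<open>c\<close> lies on
    \<open>T\<close>.\<close>
  have "y \<notin> inside (AB \<union> (AD \<union> BD))"
  proof
    assume *: "y \<in> inside (AB \<union> (AD \<union> BD))"
    have "CD - {d} \<subseteq> inside (AB \<union> (AD \<union> BD))"
    proof (rule connected_subset_inside[OF _ _ _ *])
      show "connected (CD - {d})" by (rule arc_between_connected_remove_end[OF arcs(6)])
      show "(CD - {d}) \<inter> (AB \<union> (AD \<union> BD)) = {}" using int(6,14,15) by blast
    qed (use y in blast)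
    moreover have "c \<in> CD - {d}" using ends(6) dist(6) by blast
    ultimately show False using split1 c_notin by blast
  qed
  moreover have "y \<notin> AD \<union> BD" using y int(14,15) by blast
  moreover have eq: "(AC \<union> BC) \<union> (AD \<union> BD) = (AC \<union> AD) \<union> (BC \<union> BD)" by blast
  ultimately have y_Q: "y \<in> inside ((AC \<union> AD) \<union> (BC \<union> BD))"
    using y_in split1 by auto
  have split2: "inside ((AC \<union> AD) \<union> CD) \<union> inside ((BC \<union> BD) \<union> CD) \<union> (CD - {c, d})
      = inside ((AC \<union> AD) \<union> (BC \<union> BD))"
  proof (rule theta_inside_split[OF CAD CBD arcs(6)])
    show "CD \<inter> inside ((AC \<union> AD) \<union> (BC \<union> BD)) \<noteq> {}" using y(1) y_Q by blast
  qed (simp_all add: Int_Un_distrib Int_Un_distrib2 int' insert_commute)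
  have *: "inside T = inside (AB \<union> (AD \<union> BD)) \<union>
      (inside ((AC \<union> AD) \<union> CD) \<union> inside ((BC \<union> BD) \<union> CD) \<union> (CD - {c, d})) \<union> ((AD \<union> BD) - {a, b})"
    unfolding split2 by (rule split1[symmetric, unfolded eq])
  have "c \<notin> AD" using int(7) ends(2) dist(2) by (metis IntI singletonD)
  moreover have "c \<notin> BD" using int(8) ends(2) by blast
  moreover have "a \<notin> CD" using int(6) ends(1) by blast
  moreover have "b \<notin> CD" using int(6) ends(1) by blast
  ultimately have "(CD - {c, d}) \<union> ((AD \<union> BD) - {a, b}) = AD \<union> BD \<union> CD - {a, b, c}"
    using ends(4) dist(4,5) by auto
  then show ?thesis using * unfolding T_def by (auto simp: Un_assoc)
qed

text \<open>The arc \<open>ED\<close> forces \<open>e\<close> inside as well, so into one of the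
  three small triangles; the arc from \<open>e\<close> to the opposite corner then puts that corner
  inside the triangle on which it lies. The hypotheses mention only arcs and their incidences, so
  they carry over to images under an inversion.\<close>

lemma K5_no_inside_vertex:
  assumes arcs: "arc_between AB a b" "arc_between AC a c" "arc_between BC b c"
      "arc_between AD a d" "arc_between BD b d" "arc_between CD c d"
    and arcs5: "arc_between EA a e" "arc_between EB b e" "arc_between EC c e" "arc_between ED d e"
    and int: "AB \<inter> AC = {a}" "AB \<inter> BC = {b}" "AC \<inter> BC = {c}"
      "AB \<inter> AD = {a}" "AB \<inter> BD = {b}" "AB \<inter> CD = {}"
      "AC \<inter> AD = {a}" "AC \<inter> BD = {}" "AC \<inter> CD = {c}"
      "BC \<inter> AD = {}" "BC \<inter> BD = {b}" "BC \<inter> CD = {c}"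
      "AD \<inter> BD = {d}" "AD \<inter> CD = {d}" "BD \<inter> CD = {d}"
    and int5: "EA \<inter> BC = {}" "EA \<inter> BD = {}" "EA \<inter> CD = {}"
      "EB \<inter> AC = {}" "EB \<inter> AD = {}" "EB \<inter> CD = {}"
      "EC \<inter> AB = {}" "EC \<inter> AD = {}" "EC \<inter> BD = {}"
      "ED \<inter> AB = {}" "ED \<inter> AC = {}" "ED \<inter> BC = {}"
      "e \<notin> AD" "e \<notin> BD" "e \<notin> CD"
  shows "d \<notin> inside (AB \<union> AC \<union> BC)"
proof
  assume d: "d \<in> inside (AB \<union> AC \<union> BC)"
  note ends = arcs[THEN arc_between_ends]
  note ends5 = arcs5[THEN arc_between_ends]
  note conn = arcs5[THEN arc_between_connected]
  define T where "T = AB \<union> AC \<union> BC"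
  have dT: "d \<in> inside T" using d by (simp add: T_def)
  have split: "inside T = inside (AB \<union> AD \<union> BD) \<union> inside (AC \<union> AD \<union> CD) \<union>
      inside (BC \<union> BD \<union> CD) \<union> (AD \<union> BD \<union> CD - {a, b, c})"
    unfolding T_def by (rule K4_inside_split[OF arcs int d])
  have "ED \<inter> T = {}" using int5(10-12) unfolding T_def by blast
  then have "e \<in> inside T"
    using connected_subset_inside[OF conn(4) _ _ dT] ends5(4) by blast
  then consider "e \<in> inside (AB \<union> AD \<union> BD)" | "e \<in> inside (AC \<union> AD \<union> CD)"
    | "e \<in> inside (BC \<union> BD \<union> CD)"
    using split int5(13-15) by blast
  then have "a \<in> inside T \<or> b \<in> inside T \<or> c \<in> inside T"
  proof cases
    case 1
    have "EC \<inter> (AB \<union> AD \<union> BD) = {}" using int5(7-9) by blast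
    then have "c \<in> inside (AB \<union> AD \<union> BD)"
      using connected_subset_inside[OF conn(3) _ _ 1] ends5(3) by blast
    then show ?thesis using split by blast
  next
    case 2
    have "EB \<inter> (AC \<union> AD \<union> CD) = {}" using int5(4-6) by blast
    then have "b \<in> inside (AC \<union> AD \<union> CD)"
      using connected_subset_inside[OF conn(2) _ _ 2] ends5(2) by blast
    then show ?thesis using split by blast
  next
    case 3
    have "EA \<inter> (BC \<union> BD \<union> CD) = {}" using int5(1-3) by blast
    then have "a \<in> inside (BC \<union> BD \<union> CD)"
      using connected_subset_inside[OF conn(1) _ _ 3] ends5(1) by blast
    then show ?thesis using split by blast
  qed
  moreover have "a \<in> T" "b \<in> T" "c \<in> T" using ends(1,2) unfolding T_def by blast+
  moreover have "T \<inter> inside T = {}" using inside_no_overlap by blast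
  ultimately show False by blast
qed

section \<open>Inversion, and the impossibility of drawing the complete graph on five
  vertices\<close>

text \<open>If the image of \<open>w\<close> were not inside, its component would be unbounded. Far
  points of that component come from points near \<open>z\<close>, which are inside
  \<open>S\<close>, so pulling the component back would connect \<open>w\<close> with the inside of
  \<open>S\<close>.\<close>

lemma inversion_inside:
  fixes S :: "complex set"
  assumes "compact S" and z: "z \<in> inside S" and w: "w \<in> outside S"
  shows "1 / (w - z) \<in> inside ((\<lambda>u. 1 / (u - z)) ` S)"
proof (rule ccontr)
  define g where "g u = 1 / (u - z)" for u
  define h where "h u = 1 / u + z" for u
  \<comment> \<open>Because of \<open>1 / 0 = 0\<close>, the two maps are mutually inverse even at
    \<open>z\<close> and \<open>0\<close>.\<close>
  have hg: "h (g u) = u" for u by (simp add: g_def h_def)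
  have gh: "g (h u) = u" for u by (simp add: g_def h_def)
  define C where "C = connected_component_set (- g ` S) (g w)"
  assume "1 / (w - z) \<notin> inside ((\<lambda>u. 1 / (u - z)) ` S)"
  then have "g w \<notin> inside (g ` S)" by (simp add: g_def[abs_def])
  moreover have zS: "z \<notin> S" using z by (auto simp: inside_def)
  have wS: "w \<notin> S" using w by (auto simp: outside_def)
  then have gwS: "g w \<notin> g ` S" using hg by (metis imageE)
  ultimately have unb: "\<not> bounded C" unfolding inside_def C_def by auto
  have "continuous_on S g" unfolding g_def using zS by (intro continuous_intros) auto
  then have "closed (g ` S)" using assms(1) compact_continuous_image compact_imp_closed by blast
  then have "open C" unfolding C_def by (intro open_connected_component) auto
  \<comment> \<open>\<open>0\<close> corresponds to the point at infinity, and \<open>h\<close> is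
    discontinuous there. A connected open set in the plane stays connected when a point is
    removed.\<close>
  then have conn: "connected (C - {0})"
    unfolding C_def by (intro connected_open_delete) auto
  have wz: "w \<noteq> z" using z w inside_Int_outside by blast
  have gwC: "g w \<in> C - {0}" unfolding C_def using gwS wz by (auto simp: g_def)
  have hC: "connected (h ` (C - {0}))"
    unfolding h_def by (intro connected_continuous_image conn continuous_intros) auto
  have CS: "C \<inter> g ` S = {}" unfolding C_def using connected_component_subset by fastforce
  have disj: "h ` (C - {0}) \<inter> S = {}"
  proof -
    have "h u \<notin> S" if "u \<in> C" for u
      using imageI[of "h u" S g] that CS gh[of u] by auto
    then show ?thesis by blast
  qed
  obtain r where r: "r > 0" "ball z r \<subseteq> inside S"
    using open_inside[OF compact_imp_closed[OF assms(1)]] z open_contains_ball by blast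
  obtain x where x: "x \<in> C" "norm x > 1 / r"
    using unb unfolding bounded_iff by (meson not_le)
  have x0: "x \<noteq> 0" using x r by auto
  have "norm (1 / x) < r"
    using x r x0 by (simp add: norm_divide field_simps)
  then have "h x \<in> inside S" using r(2) by (auto simp: h_def dist_norm)
  then have "h ` (C - {0}) \<subseteq> inside S"
    using connected_subset_inside[OF hC disj] x(1) x0 by blast
  then have "w \<in> inside S" using gwC hg by (metis imageI subsetD)
  then show False using w inside_Int_outside by blast
qed

lemma arc_between_image:
  assumes "arc_between S a b" "continuous_on S f" "inj_on f S"
  shows "arc_between (f ` S) (f a) (f b)"
proof -
  obtain c where c: "arc c" "pathstart c = a" "pathfinish c = b" "path_image c = S"
    using assms unfolding arc_between_def by blast
  have "path (f \<circ> c)" using c assms by (intro path_continuous_image arc_imp_path) auto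
  moreover have "inj_on (f \<circ> c) {0..1}"
    using c assms by (intro comp_inj_on) (auto simp: arc_def path_image_def)
  ultimately show ?thesis unfolding arc_between_def using c
    by (intro exI[of _ "f \<circ> c"]) (auto simp: arc_def path_image_compose pathstart_compose pathfinish_compose)
qed

text \<open>By \<open>K5_no_inside_vertex\<close> the point \<open>d\<close> is outside the
  triangle, and then no part of the drawing enters its inside. An inversion at a point
  \<open>z\<close> there is therefore continuous on the whole drawing and moves \<open>d\<close>
  inside, against the same lemma.\<close>

lemma K5_no_plane_arcs:
  assumes arcs: "arc_between AB a b" "arc_between AC a c" "arc_between BC b c"
      "arc_between AD a d" "arc_between BD b d" "arc_between CD c d"
      "arc_between EA a e" "arc_between EB b e" "arc_between EC c e" "arc_between ED d e"
    and int: "AB \<inter> AC = {a}" "AB \<inter> BC = {b}" "AC \<inter> BC = {c}"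
      "AB \<inter> AD = {a}" "AB \<inter> BD = {b}" "AB \<inter> CD = {}"
      "AC \<inter> AD = {a}" "AC \<inter> BD = {}" "AC \<inter> CD = {c}"
      "BC \<inter> AD = {}" "BC \<inter> BD = {b}" "BC \<inter> CD = {c}"
      "AD \<inter> BD = {d}" "AD \<inter> CD = {d}" "BD \<inter> CD = {d}"
      "EA \<inter> AB = {a}" "EA \<inter> AC = {a}" "EB \<inter> AB = {b}" "EB \<inter> BC = {b}"
      "EC \<inter> AC = {c}" "EC \<inter> BC = {c}"
      "EA \<inter> BC = {}" "EA \<inter> BD = {}" "EA \<inter> CD = {}"
      "EB \<inter> AC = {}" "EB \<inter> AD = {}" "EB \<inter> CD = {}"
      "EC \<inter> AB = {}" "EC \<inter> AD = {}" "EC \<inter> BD = {}"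
      "ED \<inter> AB = {}" "ED \<inter> AC = {}" "ED \<inter> BC = {}"
    and e: "e \<notin> AD" "e \<notin> BD" "e \<notin> CD"
  shows False
proof -
  define T where "T = AB \<union> AC \<union> BC"
  define X where "X = T \<union> (AD \<union> BD \<union> CD) \<union> (EA \<union> EB \<union> EC) \<union> ED"
  note ends = arcs[THEN arc_between_ends]
  note dist = arcs[THEN arc_between_distinct]
  have d_notin: "d \<notin> inside T"
    unfolding T_def by (rule K5_no_inside_vertex[OF arcs int(1-15) int(22-33) e])
  have T_notin: "T \<inter> inside T = {}" using inside_no_overlap by blast
  have dAB: "d \<notin> AB" using int(4) ends(4) dist(4) by (metis IntI singletonD)
  have dAC: "d \<notin> AC" using int(7) ends(4) dist(4) by (metis IntI singletonD)
  have "d \<notin> BC" using int(10) ends(4) by blast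
  with dAB dAC have "d \<notin> T" unfolding T_def by blast
  then have d_out: "d \<in> outside T" using d_notin inside_Un_outside by blast
  have "ED \<inter> T = {}" using int(31-33) unfolding T_def by blast
  then have ED_out: "ED \<inter> inside T = {}"
    using connected_subset_inside[OF arc_between_connected[OF arcs(10)], of T]
      d_notin ends(10) by blast
  \<comment> \<open>Without \<open>u\<close> the arc is connected and misses \<open>T\<close>, so a
    single point of it inside would bring \<open>v\<close> inside.\<close>
  have arm: "S \<inter> inside T = {}" if S: "arc_between S u v" "v \<notin> inside T" "S \<inter> T = {u}" for S u v
  proof -
    have conn: "connected (S - {u})"
      using arc_between_connected_remove_end[OF arc_between_sym[OF S(1)]] .
    have disj: "(S - {u}) \<inter> T = {}" using S(3) by blast
    have v: "v \<in> S - {u}" using arc_between_ends[OF S(1)] arc_between_distinct[OF S(1)] by blast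
    have "x \<notin> inside T" if "x \<in> S - {u}" for x
      using connected_subset_inside[OF conn disj that] v S(2) by blast
    moreover have "u \<notin> inside T" using S(3) T_notin by blast
    ultimately show ?thesis by blast
  qed
  have e_notin: "e \<notin> inside T" using ED_out ends(10) by blast
  note int' = int int[THEN trans[OF Int_commute]]
  have "AD \<inter> inside T = {}"
    by (rule arm[OF arcs(4) d_notin]) (simp add: T_def Int_Un_distrib int')
  moreover have "BD \<inter> inside T = {}"
    by (rule arm[OF arcs(5) d_notin]) (simp add: T_def Int_Un_distrib int')
  moreover have "CD \<inter> inside T = {}"
    by (rule arm[OF arcs(6) d_notin]) (simp add: T_def Int_Un_distrib int')
  moreover have "EA \<inter> inside T = {}"
    by (rule arm[OF arcs(7) e_notin]) (simp add: T_def Int_Un_distrib int')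
  moreover have "EB \<inter> inside T = {}"
    by (rule arm[OF arcs(8) e_notin]) (simp add: T_def Int_Un_distrib int')
  moreover have "EC \<inter> inside T = {}"
    by (rule arm[OF arcs(9) e_notin]) (simp add: T_def Int_Un_distrib int')
  ultimately have X: "X \<inter> inside T = {}" using ED_out T_notin unfolding X_def by blast
  have ACB: "arc_between (AC \<union> BC) a b"
    by (rule arc_between_join[OF arcs(2) arc_between_sym[OF arcs(3)] int(3)])
  have "inside (AB \<union> (AC \<union> BC)) \<noteq> {}"
    by (rule arc_between_loop_inside_nonempty[OF arcs(1) ACB])
      (simp add: Int_Un_distrib int' insert_commute)
  then obtain z where z: "z \<in> inside T" unfolding T_def by (auto simp: Un_assoc)
  have zX: "z \<notin> X" using z X by blast
  define g where "g u = 1 / (u - z)" for u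
  \<comment> \<open>Injective on the whole plane, again by \<open>1 / 0 = 0\<close>.\<close>
  have inj: "inj g" unfolding g_def by (intro injI) auto
  have cont: "continuous_on X g" unfolding g_def using zX by (intro continuous_intros) auto
  have compT: "compact T"
    unfolding T_def using arcs arc_between_compact by blast
  have gd: "g d \<in> inside (g ` AB \<union> g ` AC \<union> g ` BC)"
    using inversion_inside[OF compT z d_out] unfolding g_def[symmetric] T_def
    by (simp add: image_Un)
  have garc: "arc_between (g ` S) (g u) (g v)" if "arc_between S u v" "S \<subseteq> X" for S u v
    using arc_between_image[OF that(1)] continuous_on_subset[OF cont that(2)]
      inj_on_subset[OF inj] by blast
  have sub: "AB \<subseteq> X" "AC \<subseteq> X" "BC \<subseteq> X" "AD \<subseteq> X" "BD \<subseteq> X" "CD \<subseteq> X" "EA \<subseteq> X" "EB \<subseteq> X"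
    "EC \<subseteq> X" "ED \<subseteq> X"
    unfolding X_def T_def by blast+
  have "g d \<notin> inside (g ` AB \<union> g ` AC \<union> g ` BC)"
    by (rule K5_no_inside_vertex[OF arcs(1)[THEN garc, OF sub(1)] arcs(2)[THEN garc, OF sub(2)]
          arcs(3)[THEN garc, OF sub(3)] arcs(4)[THEN garc, OF sub(4)] arcs(5)[THEN garc, OF sub(5)]
          arcs(6)[THEN garc, OF sub(6)] arcs(7)[THEN garc, OF sub(7)] arcs(8)[THEN garc, OF sub(8)]
          arcs(9)[THEN garc, OF sub(9)] arcs(10)[THEN garc, OF sub(10)]])
      (simp_all add: image_Int[OF inj, symmetric] inj_image_mem_iff[OF inj] int e)
  then show False using gd by contradiction
qed

theorem clique_5_not_planar:
  assumes "is_clique G K" "card K = 5"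
  shows "\<not> planar_graph G"
proof
  assume "planar_graph G"
  then obtain p \<gamma> where dr: "plane_drawing G p \<gamma>" unfolding planar_graph_def by blast
  obtain xs where xs: "set xs = K" "distinct xs" "length xs = 5"
    using assms(2) by (metis card.infinite distinct_card finite_distinct_list zero_neq_numeral)
  obtain v1 v2 v3 v4 v5 where "xs = [v1, v2, v3, v4, v5]"
    using xs(3) by (auto simp: eval_nat_numeral length_Suc_conv)
  then have K: "K = {v1, v2, v3, v4, v5}" 
    and dis: "v1 \<noteq> v2" "v1 \<noteq> v3" "v1 \<noteq> v4" "v1 \<noteq> v5" "v2 \<noteq> v3" "v2 \<noteq> v4" "v2 \<noteq> v5"
      "v3 \<noteq> v4" "v3 \<noteq> v5" "v4 \<noteq> v5"
    using xs by auto
  define E where "E u v = path_image (\<gamma> {u, v})" for u v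
  have edge: "{u, v} \<in> edges G" if "u \<in> K" "v \<in> K" "u \<noteq> v" for u v
    using assms(1) that unfolding is_clique_def adjacent_def by blast
  have KV: "K \<subseteq> verts G" using assms(1) by (simp add: is_clique_def)
  have inj: "inj_on p K" using dr KV by (auto simp: plane_drawing_def intro: inj_on_subset)
  have arcE: "arc_between (E u v) (p u) (p v)" if uv: "u \<in> K" "v \<in> K" "u \<noteq> v" for u v
  proof -
    have "arc (\<gamma> {u, v})" "{pathstart (\<gamma> {u, v}), pathfinish (\<gamma> {u, v})} = {p u, p v}"
      using dr edge[OF uv] unfolding plane_drawing_def by auto
    \<comment> \<open>The arc drawn for an unordered edge may run in either direction.\<close>
    then have "arc_between (E u v) (p u) (p v) \<or> arc_between (E u v) (p v) (p u)"
      unfolding arc_between_def E_def by (auto simp: doubleton_eq_iff)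
    then show ?thesis using arc_between_sym by blast
  qed
  have dr3: "path_image (\<gamma> e) \<inter> p ` verts G = p ` e" if "e \<in> edges G" for e
    using dr that unfolding plane_drawing_def by blast
  have dr4: "path_image (\<gamma> e) \<inter> path_image (\<gamma> f) = p ` (e \<inter> f)"
    if "e \<in> edges G" "f \<in> edges G" "e \<noteq> f" for e f
    using dr that unfolding plane_drawing_def by blast
  have intE: "E u v \<inter> E x y = p ` ({u, v} \<inter> {x, y})"
    if "u \<in> K" "v \<in> K" "u \<noteq> v" "x \<in> K" "y \<in> K" "x \<noteq> y" "{u, v} \<noteq> {x, y}" for u v x y
    unfolding E_def by (intro dr4 edge that)
  have vtxE: "p w \<notin> E u v" if "u \<in> K" "v \<in> K" "u \<noteq> v" "w \<in> K" "w \<noteq> u" "w \<noteq> v" for u v w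
  proof
    assume "p w \<in> E u v"
    then have "p w \<in> p ` {u, v}"
      using dr3[OF edge[OF that(1-3)]] KV that(4) unfolding E_def by blast
    then show False using inj that by (auto simp: inj_on_def)
  qed
  show False
    by (rule K5_no_plane_arcs[OF arcE[of v1 v2] arcE[of v1 v3] arcE[of v2 v3] arcE[of v1 v4]
          arcE[of v2 v4] arcE[of v3 v4] arcE[of v1 v5] arcE[of v2 v5] arcE[of v3 v5] arcE[of v4 v5]])
      (use dis dis[symmetric] in \<open>simp_all add: K intE vtxE doubleton_eq_iff\<close>)
qed

section \<open>Eulerian graphs\<close>

lemma walk_edges_Nil [simp]: "walk_edges [] = []"
  and walk_edges_single [simp]: "walk_edges [v] = []"
  and walk_edges_Cons_Cons [simp]: "walk_edges (u # v # vs) = {u, v} # walk_edges (v # vs)"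
  by (simp_all add: walk_edges_def)

lemma walk_edges_append:
  "walk_edges (us @ v # vs) = walk_edges (us @ [v]) @ walk_edges (v # vs)"
proof (induction us)
  case (Cons u us)
  then show ?case by (cases us) auto
qed simp

lemma walk_edges_snoc:
  assumes "vs \<noteq> []"
  shows "walk_edges (vs @ [v]) = walk_edges vs @ [{last vs, v}]"
proof -
  have "vs = butlast vs @ [last vs]" using assms by simp
  then show ?thesis using walk_edges_append[of "butlast vs" "last vs" "[v]"]
    by (metis append.assoc append_Cons append_Nil walk_edges_Cons_Cons walk_edges_single)
qed

lemma walk_edges_incident:
  "e \<in> set (walk_edges vs) \<Longrightarrow> v \<in> e \<Longrightarrow> v \<in> set vs"
  by (induction vs rule: induct_list012) auto

text \<open>A trail enters and leaves an inner vertex by a pair of edges, so only its ends can have odd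
  degree in it.\<close>

lemma trail_degree_parity:
  assumes "vs \<noteq> []" "distinct (walk_edges vs)" "\<And>e. e \<in> set (walk_edges vs) \<Longrightarrow> card e = 2"
  shows "even (card {e \<in> set (walk_edges vs). v \<in> e}) \<longleftrightarrow> (v = hd vs \<longleftrightarrow> v = last vs)"
  using assms
proof (induction vs rule: induct_list012)
  case (3 x y zs)
  define E where "E = {e \<in> set (walk_edges (y # zs)). v \<in> e}"
  have IH: "even (card E) \<longleftrightarrow> (v = y \<longleftrightarrow> v = last (y # zs))"
    unfolding E_def using 3 by simp
  have "card {x, y} = 2" using 3(5)[of "{x, y}"] by simp
  then have "x \<noteq> y" by auto
  have fin: "finite E" and notin: "{x, y} \<notin> E" using 3(4) by (auto simp: E_def)
  show ?case
  proof (cases "v \<in> {x, y}")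
    case True
    then have "{e \<in> set (walk_edges (x # y # zs)). v \<in> e} = insert {x, y} E"
      by (auto simp: E_def)
    then show ?thesis using fin notin IH True \<open>x \<noteq> y\<close> by auto
  next
    case False
    then have "{e \<in> set (walk_edges (x # y # zs)). v \<in> e} = E"
      by (auto simp: E_def)
    then show ?thesis using IH False by auto
  qed
qed auto

text \<open>Used to find an edge that leaves the vertex set of a trail.\<close>

lemma walk_leaves_set:
  assumes "is_walk G vs" "hd vs \<in> T" "last vs \<notin> T"
  obtains u v where "u \<in> T" "v \<notin> T" "{u, v} \<in> edges G"
proof -
  have "\<exists>u v. u \<in> T \<and> v \<notin> T \<and> {u, v} \<in> edges G"
    using assms
  proof (induction vs rule: induct_list012)
    case (3 x y zs)
    then show ?case by (cases "y \<in> T") (auto simp: is_walk_def)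
  qed (auto simp: is_walk_def)
  then show ?thesis using that by blast
qed

text \<open>The closed walk is cut at \<open>v\<close> and its two pieces are joined in the opposite
  order. Equality of multisets keeps trails trails.\<close>

lemma closed_walk_rotate:
  assumes "is_walk G vs" "hd vs = last vs" "v \<in> set vs"
  obtains ws where "is_walk G ws" "hd ws = v" "last ws = v"
    "mset (walk_edges ws) = mset (walk_edges vs)"
proof (cases "v = hd vs")
  case True
  then show ?thesis using that[OF assms(1)] assms(2) by metis
next
  case False
  obtain as bs where vs: "vs = as @ v # bs" using assms(3) by (meson split_list)
  obtain a as' where as: "as = a # as'" using False vs by (cases as) auto
  have "bs \<noteq> []"
  proof
    assume "bs = []"
    then have "last vs = v" by (simp add: vs)
    then show False using False assms(2) by simp
  qed
  moreover from this have "last bs = a" using assms(2) by (simp add: vs as)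
  ultimately
  obtain cs where bs: "bs = cs @ [a]" by (metis append_butlast_last_id)
  \<comment> \<open>The given walk is \<open>a # as' @ v # cs @ [a]\<close>; the new one goes from
    \<open>v\<close> along \<open>cs\<close> to \<open>a\<close> and returns along
    \<open>as'\<close>.\<close>
  define ws where "ws = (v # cs) @ a # as' @ [v]"
  have "walk_edges ws = walk_edges (v # bs) @ walk_edges (a # as' @ [v])"
    unfolding ws_def bs using walk_edges_append[of "v # cs" a "as' @ [v]"] by simp
  moreover have "walk_edges vs = walk_edges (a # as' @ [v]) @ walk_edges (v # bs)"
    using walk_edges_append[of "a # as'" v bs] by (simp only: vs as append_Cons)
  ultimately have mset: "mset (walk_edges ws) = mset (walk_edges vs)"
    by (simp only: mset_append add.commute)
  have "set ws = set vs" by (auto simp: ws_def vs as bs)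
  moreover have "ws \<noteq> []" "hd ws = v" "last ws = v" by (simp_all add: ws_def)
  ultimately show ?thesis
    using that[of ws] mset assms(1) mset_eq_setD[OF mset] by (simp only: is_walk_def simp_thms)
qed

theorem eulerian_iff_even_degrees:
  assumes conn: "connected_graph G" and fin: "finite (edges G)"
    and edges: "\<And>e. e \<in> edges G \<Longrightarrow> e \<subseteq> verts G \<and> card e = 2"
  shows "eulerian_graph G \<longleftrightarrow> (\<forall>v\<in>verts G. even (vertex_degree G v))"
proof
  assume "eulerian_graph G"
  then obtain vs where vs: "is_walk G vs" "hd vs = last vs" "distinct (walk_edges vs)"
    "set (walk_edges vs) = edges G"
    unfolding eulerian_graph_def by blast
  show "\<forall>v\<in>verts G. even (vertex_degree G v)"
    using trail_degree_parity[OF _ vs(3)] vs edges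
    unfolding vertex_degree_def is_walk_def by auto
next
  assume even: "\<forall>v\<in>verts G. even (vertex_degree G v)"
  define trail where "trail vs \<longleftrightarrow> is_walk G vs \<and> distinct (walk_edges vs)" for vs
  obtain v0 where v0: "v0 \<in> verts G" using conn unfolding connected_graph_def by blast
  have bound: "length (walk_edges vs) \<le> card (edges G)" if "trail vs" for vs
    using that fin unfolding trail_def is_walk_def
    by (metis card_mono distinct_card)
  have "trail [v0]" using v0 by (simp add: trail_def is_walk_def)
  then obtain vs where vs: "trail vs"
    and max: "\<And>ws. trail ws \<Longrightarrow> length (walk_edges ws) \<le> length (walk_edges vs)"
    using ex_has_greatest_nat[of trail "[v0]" "\<lambda>ws. length (walk_edges ws)" "Suc (card (edges G))"] bound
    by (auto simp: less_Suc_eq_le)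
  \<comment> \<open>Stated for all trails of maximal length, because it is applied to
    \<open>vs\<close> and to a rotation of \<open>vs\<close>.\<close>
  have no_extension: "{last ws, x} \<notin> edges G - set (walk_edges ws)"
    if "trail ws" "length (walk_edges ws) = length (walk_edges vs)" for ws x
  proof
    assume x: "{last ws, x} \<in> edges G - set (walk_edges ws)"
    have ne: "ws \<noteq> []" using that by (auto simp: trail_def is_walk_def)
    have "trail (ws @ [x])"
      using that(1) x edges[of "{last ws, x}"] walk_edges_snoc[OF ne, of x]
      by (auto simp: trail_def is_walk_def)
    then show False using max[of "ws @ [x]"] that(2) walk_edges_snoc[OF ne, of x] by simp
  qed
  have walk: "is_walk G vs" and dist: "distinct (walk_edges vs)" and ne: "vs \<noteq> []"
    and sub: "set (walk_edges vs) \<subseteq> edges G" and inV: "set vs \<subseteq> verts G"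
    using vs by (auto simp: trail_def is_walk_def)
  have closed: "hd vs = last vs"
  proof (rule ccontr)
    assume "hd vs \<noteq> last vs"
    then have "odd (card {e \<in> set (walk_edges vs). last vs \<in> e})"
      using trail_degree_parity[OF ne dist, of "last vs"] edges sub by auto
    moreover have "even (card {e \<in> edges G. last vs \<in> e})"
      using even inV last_in_set[OF ne] unfolding vertex_degree_def by blast
    ultimately have "{e \<in> set (walk_edges vs). last vs \<in> e} \<noteq> {e \<in> edges G. last vs \<in> e}" by metis
    then obtain e where e: "e \<in> edges G - set (walk_edges vs)" "last vs \<in> e" using sub by blast
    then obtain x where "e = {last vs, x}"
      using edges[of e] by (auto simp: card_2_iff)
    then show False using no_extension[OF vs refl] e by blast
  qed
  have "set (walk_edges vs) = edges G"
  proof (rule ccontr)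
    assume "set (walk_edges vs) \<noteq> edges G"
    then obtain e where e: "e \<in> edges G - set (walk_edges vs)" using sub by blast
    then obtain a b where ab: "e = {a, b}" "a \<in> verts G" using edges[of e] by (auto simp: card_2_iff)
    have "\<exists>v x. v \<in> set vs \<and> {v, x} \<in> edges G - set (walk_edges vs)"
    proof (cases "a \<in> set vs")
      case True
      then show ?thesis using e ab by blast
    next
      case False
      obtain ws where "is_walk G ws" "hd ws = hd vs" "last ws = a"
        using conn ab(2) inV ne unfolding connected_graph_def walk_between_def
        by (metis hd_in_set subsetD)
      then obtain u v where "u \<in> set vs" "v \<notin> set vs" "{u, v} \<in> edges G"
        using walk_leaves_set[of G ws "set vs"] False ne by auto
      then show ?thesis using walk_edges_incident[of "{u, v}" vs v] by blast
    qed
    then obtain v x where v: "v \<in> set vs" and x: "{v, x} \<in> edges G - set (walk_edges vs)" by blast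
    obtain ws where ws: "is_walk G ws" "last ws = v" "mset (walk_edges ws) = mset (walk_edges vs)"
      using closed_walk_rotate[OF walk closed v] by blast
    have "trail ws" using ws dist mset_eq_imp_distinct_iff by (auto simp: trail_def)
    moreover have "length (walk_edges ws) = length (walk_edges vs)"
      using ws(3) by (rule mset_eq_length)
    ultimately show False using no_extension[of ws x] x ws(2) mset_eq_setD[OF ws(3)] by auto
  qed
  then show "eulerian_graph G"
    unfolding eulerian_graph_def using walk closed dist by blast
qed

section \<open>Adjacency and degrees in the generating graph of a finite cyclic group\<close>

lemma verts_zmod: "n > 0 \<Longrightarrow> verts (zmod_generating_graph n) = {0..<int n}"
  by (simp add: zmod_generating_graph_def generating_graph_def carrier_integer_mod_group)

text \<open>Bezout coefficients express every residue by \<open>a\<close> and \<open>b\<close>.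
  Conversely, the multiples of the common divisor \<open>d\<close> are closed under the group
  operations, so \<open>d\<close> divides whatever is generated.\<close>

lemma generate_integer_mod_group_eq_carrier_iff:
  assumes n: "n > 0" and a: "a \<in> {0..<int n}" and b: "b \<in> {0..<int n}"
  shows "generate (integer_mod_group n) {a, b} = carrier (integer_mod_group n) \<longleftrightarrow>
         coprime (gcd a b) (int n)"
proof -
  let ?G = "integer_mod_group n"
  have carr: "carrier ?G = {0..<int n}" using n by (simp add: carrier_integer_mod_group)
  interpret group ?G by simp
  have ab: "{a, b} \<subseteq> carrier ?G" using a b carr by simp
  note sub = generate_is_subgroup[OF ab]
  show ?thesis
  proof
    assume *: "coprime (gcd a b) (int n)"
    obtain x y where "x * gcd a b + y * int n = 1"
      using * bezout_int[of "gcd a b" "int n"] unfolding coprime_iff_gcd_eq_1 by metis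
    moreover obtain u v where "u * a + v * b = gcd a b" using bezout_int by blast
    ultimately have one: "x * (u * a + v * b) + y * int n = 1" by simp
    have "c \<in> generate ?G {a, b}" if c: "c \<in> {0..<int n}" for c
    proof -
      \<comment> \<open>The exponents are the coefficients from \<open>one\<close> multiplied by
        \<open>c\<close>, so the product is \<open>c\<close> modulo \<open>n\<close>.\<close>
      have "(a [^]\<^bsub>?G\<^esub> (c * x * u)) \<otimes>\<^bsub>?G\<^esub> (b [^]\<^bsub>?G\<^esub> (c * x * v)) \<in> generate ?G {a, b}"
        using sub subgroup_int_pow_closed[OF sub] generate.incl[of _ "{a, b}" ?G]
        by (intro subgroup.m_closed) auto
      moreover have "(a [^]\<^bsub>?G\<^esub> (c * x * u)) \<otimes>\<^bsub>?G\<^esub> (b [^]\<^bsub>?G\<^esub> (c * x * v)) =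
          (c * (x * (u * a + v * b))) mod int n"
        by (simp add: int_pow_integer_mod_group mod_add_eq algebra_simps)
      moreover have "c * (x * (u * a + v * b)) = c - c * y * int n"
        using one by (metis (no_types, opaque_lifting) add_diff_cancel_right' mult.assoc mult.right_neutral
            right_diff_distrib)
      ultimately show ?thesis using c by (simp add: mod_diff_eq[symmetric] del: mod_diff_eq)
    qed
    then show "generate ?G {a, b} = carrier ?G"
      using generate_incl[OF ab] carr by blast
  next
    assume *: "generate ?G {a, b} = carrier ?G"
    define d where "d = gcd (gcd a b) (int n)"
    have d: "d dvd a" "d dvd b" "d dvd int n" by (auto simp: d_def intro: dvd_trans)
    have "d dvd c" if "c \<in> generate ?G {a, b}" for c
      using that
    proof induction
      case (inv h)
      then show ?case using ab d by (auto simp: dvd_mod_iff)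
    qed (use d in \<open>auto simp: dvd_mod_iff\<close>)
    \<comment> \<open>\<open>1\<close> is an element of the group only for
      \<open>n \<noteq> 1\<close>; for \<open>n = 1\<close> the divisor \<open>d\<close> of
      \<open>n\<close> is a unit anyway.\<close>
    then have "n \<noteq> 1 \<Longrightarrow> d dvd 1" unfolding * integer_mod_group_1[symmetric] by blast
    then have "d dvd 1" using d(3) by (cases "n = 1") simp_all
    then show "coprime (gcd a b) (int n)"
      by (simp only: d_def is_unit_gcd)
  qed
qed

lemma adjacent_zmod_iff:
  assumes "n > 0"
  shows "adjacent (zmod_generating_graph n) a b \<longleftrightarrow>
    a \<in> {0..<int n} \<and> b \<in> {0..<int n} \<and> a \<noteq> b \<and> coprime (gcd a b) (int n)"
    (is "_ \<longleftrightarrow> ?R a b")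
proof -
  let ?G = "integer_mod_group n"
  have "adjacent (zmod_generating_graph n) a b \<longleftrightarrow>
    (\<exists>a' b'. {a, b} = {a', b'} \<and> a' \<in> {0..<int n} \<and> b' \<in> {0..<int n} \<and> a' \<noteq> b' \<and>
       generate ?G {a', b'} = carrier ?G)"
    using assms by (auto simp: adjacent_def zmod_generating_graph_def generating_graph_def
        carrier_integer_mod_group)
  also have "\<dots> \<longleftrightarrow> (\<exists>a' b'. {a, b} = {a', b'} \<and> ?R a' b')"
    using generate_integer_mod_group_eq_carrier_iff[OF assms] by blast
  also have "\<dots> \<longleftrightarrow> ?R a b"
    by (auto simp: doubleton_eq_iff gcd.commute)
  finally show ?thesis .
qed

lemma edges_zmod:
  assumes "n > 0"
  shows "edges (zmod_generating_graph n) =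
    {{a, b} | a b. adjacent (zmod_generating_graph n) a b}"
proof -
  have "\<exists>a b. e = {a, b}" if "e \<in> edges (zmod_generating_graph n)" for e
    using that by (auto simp: zmod_generating_graph_def generating_graph_def)
  then show ?thesis unfolding adjacent_def by blast
qed

lemma adjacent_commute: "adjacent G u v \<longleftrightarrow> adjacent G v u"
  by (simp add: adjacent_def insert_commute)

lemma adjacent_zmod_unit:
  assumes "u \<in> {0..<int n}" "v \<in> {0..<int n}" "u \<noteq> v" "coprime u (int n)"
  shows "adjacent (zmod_generating_graph n) u v"
proof -
  have "coprime (gcd u v) (int n)"
    using assms(4) coprime_divisors[of "gcd u v" u "int n" "int n"] by simp
  then show ?thesis using assms by (subst adjacent_zmod_iff) auto
qed

lemma not_adjacent_zmod_common_prime: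
  assumes "p dvd n" "\<not> is_unit p" "int p dvd a" "int p dvd b" "n > 0"
  shows "\<not> adjacent (zmod_generating_graph n) a b"
proof -
  have "\<not> coprime (gcd a b) (int n)"
    using assms by (intro not_coprimeI[of "int p"]) auto
  then show ?thesis using assms by (simp add: adjacent_zmod_iff)
qed

lemma not_coprime_int_prime_factor:
  assumes "\<not> coprime a (int n)" "n > 0"
  shows "\<exists>p\<in>prime_factors n. int p dvd a"
proof -
  have "gcd a (int n) \<noteq> 1" using assms(1) by (simp add: coprime_iff_gcd_eq_1)
  then have "nat (gcd a (int n)) \<noteq> 1"
    by (metis gcd_ge_0_int nat_eq_iff2 of_nat_1)
  then obtain p where p: "prime p" "p dvd nat (gcd a (int n))" using prime_factor_nat by blast
  have "int p dvd gcd a (int n)" using p(2) by (metis dvd_nat_abs_iff gcd_ge_0_int nat_0_le of_nat_dvd_iff)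
  then have "int p dvd a" "p dvd n" by (auto simp: int_dvd_int_iff)
  then show ?thesis using p(1) assms(2) by (auto simp: in_prime_factors_iff)
qed

lemma vertex_degree_zmod:
  assumes "n > 0"
  shows "vertex_degree (zmod_generating_graph n) v = card {b. adjacent (zmod_generating_graph n) v b}"
proof -
  let ?G = "zmod_generating_graph n"
  have ne: "v \<noteq> b" if "adjacent ?G v b" for b using that assms by (simp add: adjacent_zmod_iff)
  have "{e \<in> edges ?G. v \<in> e} = (\<lambda>b. {v, b}) ` {b. adjacent ?G v b}"
    using adjacent_commute[of ?G] by (auto simp: edges_zmod[OF assms])
  moreover have "inj_on (\<lambda>b. {v, b}) {b. adjacent ?G v b}"
    by (auto simp: inj_on_def doubleton_eq_iff)
  ultimately show ?thesis by (simp add: vertex_degree_def card_image)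
qed

lemma vertex_degree_zmod_unit:
  assumes "v \<in> {0..<int n}" "coprime v (int n)"
  shows "vertex_degree (zmod_generating_graph n) v = n - 1"
proof -
  have n: "n > 0" using assms(1) by auto
  have "{b. adjacent (zmod_generating_graph n) v b} = {0..<int n} - {v}"
    using adjacent_zmod_unit[OF assms(1) _ _ assms(2)] adjacent_zmod_iff[OF n] by blast
  then show ?thesis using assms(1) by (simp add: vertex_degree_zmod[OF n])
qed

text \<open>The orbits \<open>{x, f x}\<close> have two elements each and are removed one at a
  time.\<close>

lemma even_card_fixpoint_free_involution:
  assumes "finite A" "\<And>x. x \<in> A \<Longrightarrow> f x \<in> A \<and> f (f x) = x \<and> f x \<noteq> x"
  shows "even (card A)"
  using assms
proof (induction A rule: finite_psubset_induct)
  case (psubset A)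
  show ?case
  proof (cases "A = {}")
    case False
    then obtain x where x: "x \<in> A" by blast
    have "even (card (A - {x, f x}))"
    proof (rule psubset.IH)
      show "A - {x, f x} \<subset> A" using x by blast
      fix y assume "y \<in> A - {x, f x}"
      then show "f y \<in> A - {x, f x} \<and> f (f y) = y \<and> f y \<noteq> y"
        using psubset.prems x by (metis DiffE DiffI insert_iff singletonD)
    qed
    moreover have "{x, f x} \<subseteq> A" "card {x, f x} = 2" using psubset.prems[OF x] x by auto
    ultimately show ?thesis
      using psubset.hyps card_Diff_subset[of "{x, f x}" A] card_mono[of A "{x, f x}"] by auto
  qed simp
qed

lemma even_vertex_degree_zmod:
  assumes "odd n" "v \<in> {0..<int n}"
  shows "even (vertex_degree (zmod_generating_graph n) v)"
proof (cases "coprime v (int n)")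
  case True
  then show ?thesis using vertex_degree_zmod_unit[OF assms(2)] assms(1) by simp
next
  case False
  let ?G = "zmod_generating_graph n"
  have n: "n > 0" using assms by auto
  \<comment> \<open>For a non-unit \<open>v\<close> coprimality already excludes
    \<open>b = v\<close>, as \<open>gcd v v = v\<close>. The remaining condition is symmetric under
    \<open>b \<mapsto> n - b\<close>.\<close>
  have adj: "adjacent ?G v b \<longleftrightarrow> b \<in> {0..<int n} \<and> coprime (gcd v b) (int n)" for b
    using False assms(2) by (auto simp: adjacent_zmod_iff[OF n])
  have "even (card {b. adjacent ?G v b})"
  proof (rule even_card_fixpoint_free_involution[where f = "\<lambda>b. int n - b"])
    show "finite {b. adjacent ?G v b}" by (rule finite_subset[of _ "{0..<int n}"]) (auto simp: adj)
    fix b assume "b \<in> {b. adjacent ?G v b}"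
    then have b: "b \<in> {0..<int n}" "coprime (gcd v b) (int n)" by (auto simp: adj)
    \<comment> \<open>\<open>gcd v 0 = v\<close> is not coprime to \<open>n\<close>. This keeps
      \<open>n - b\<close> below \<open>n\<close>.\<close>
    have "b \<noteq> 0" using b False by auto
    have coprime_gcd: "coprime (gcd v (int n - b)) (int n) \<longleftrightarrow> coprime (gcd v b) (int n)"
    proof -
      have "gcd (int n - b) (int n) = gcd b (int n)"
        using gcd_diff2[of "int n" b] by (simp add: gcd.commute)
      then show ?thesis by (simp only: coprime_iff_gcd_eq_1 gcd.assoc)
    qed
    have "int n - b \<noteq> b" using assms(1) by presburger
    then show "int n - b \<in> {b. adjacent ?G v b} \<and> int n - (int n - b) = b \<and> int n - b \<noteq> b"
      using b \<open>b \<noteq> 0\<close> by (simp add: adj coprime_gcd)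
  qed
  then show ?thesis by (simp add: vertex_degree_zmod[OF n])
qed

section \<open>Distances, colourings and independent sets\<close>

lemma walk_between_adjacent:
  assumes "adjacent G u v" "u \<in> verts G" "v \<in> verts G"
  shows "walk_between G u v [u, v]"
  using assms by (simp add: walk_between_def is_walk_def adjacent_def)

lemma graph_distance_le:
  assumes "walk_between G u v vs"
  shows "graph_distance G u v \<le> enat (length (walk_edges vs))"
  unfolding graph_distance_def using assms by (intro Inf_lower) blast

lemma graph_distance_ge_1:
  assumes "u \<noteq> v"
  shows "1 \<le> graph_distance G u v"
  unfolding graph_distance_def
proof (rule Inf_greatest)
  fix x assume "x \<in> {enat (length (walk_edges vs)) | vs. walk_between G u v vs}"
  then obtain vs where vs: "walk_between G u v vs" "x = enat (length (walk_edges vs))" by blast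
  \<comment> \<open>\<open>remdups_adj.cases\<close> serves only as the case split into
    \<open>[]\<close>, \<open>[x]\<close> and \<open>x # y # xs\<close>.\<close>
  then show "1 \<le> x" using assms
    by (cases vs rule: remdups_adj.cases) (auto simp: walk_between_def is_walk_def one_enat_def)
qed

lemma graph_distance_ge_2:
  assumes "u \<noteq> v" "\<not> adjacent G u v"
  shows "2 \<le> graph_distance G u v"
  unfolding graph_distance_def
proof (rule Inf_greatest)
  fix x assume "x \<in> {enat (length (walk_edges vs)) | vs. walk_between G u v vs}"
  then obtain vs where vs: "walk_between G u v vs" "x = enat (length (walk_edges vs))" by blast
  then have "walk_edges vs \<noteq> []" "\<not> (\<exists>a b. vs = [a, b])"
    using assms
    by (cases vs rule: remdups_adj.cases; auto simp: walk_between_def is_walk_def adjacent_def)+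
  then have "2 \<le> length (walk_edges vs)"
  proof (cases vs rule: remdups_adj.cases)
    case (3 a b cs)
    with \<open>\<not> (\<exists>a b. vs = [a, b])\<close> show ?thesis by (cases cs) auto
  qed simp_all
  then show "2 \<le> x" using vs(2) by (simp add: numeral_eq_enat)
qed

lemma diameter_eq_1_if_complete:
  assumes "\<And>u v. u \<in> verts G \<Longrightarrow> v \<in> verts G \<Longrightarrow> u \<noteq> v \<Longrightarrow> adjacent G u v"
    and "x \<in> verts G" "y \<in> verts G" "x \<noteq> y"
  shows "diameter_of_graph G = 1"
proof (rule antisym)
  have "graph_distance G u v \<le> 1" if "u \<in> verts G" "v \<in> verts G" for u v
  proof (cases "u = v")
    case True
    then have "walk_between G u v [u]" using that by (simp add: walk_between_def is_walk_def)
    from graph_distance_le[OF this] show ?thesis by (simp add: zero_enat_def[symmetric])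
  next
    case False
    from graph_distance_le[OF walk_between_adjacent[OF assms(1)[OF that False] that]]
    show ?thesis by (simp add: one_enat_def)
  qed
  then show "diameter_of_graph G \<le> 1" unfolding diameter_of_graph_def by (auto intro!: Sup_least)
  have "graph_distance G x y \<le> diameter_of_graph G"
    unfolding diameter_of_graph_def using assms by (intro Sup_upper) blast
  then show "1 \<le> diameter_of_graph G" using graph_distance_ge_1[OF assms(4), of G] by (rule order_trans[rotated])
qed

text \<open>Any two vertices can be joined through \<open>c\<close>; this gives connectedness and
  bounds the diameter by two.\<close>

lemma universal_vertex_walk:
  assumes "c \<in> verts G" "\<And>v. v \<in> verts G \<Longrightarrow> v \<noteq> c \<Longrightarrow> adjacent G c v"
    and "u \<in> verts G" "v \<in> verts G"
  obtains vs where "walk_between G u v vs" "length (walk_edges vs) \<le> 2"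
proof -
  consider "u = v" | "u \<noteq> v" "u = c" | "u \<noteq> v" "v = c" | "u \<noteq> c" "v \<noteq> c" by blast
  then show ?thesis
  proof cases
    case 1
    then have "walk_between G u v [u]" using assms by (simp add: walk_between_def is_walk_def)
    then show ?thesis by (rule that) simp
  next
    case 2
    then have "walk_between G u v [u, v]" using assms by (intro walk_between_adjacent) auto
    then show ?thesis by (rule that) simp
  next
    case 3
    then have "walk_between G u v [u, v]"
      using assms adjacent_commute[of G u v] by (intro walk_between_adjacent) auto
    then show ?thesis by (rule that) simp
  next
    case 4
    then have "adjacent G c u" "adjacent G c v" using assms by auto
    then have "walk_between G u v [u, c, v]"
      using assms by (simp add: walk_between_def is_walk_def adjacent_def insert_commute)
    then show ?thesis by (rule that) simp
  qed
qed

lemma connected_if_universal_vertex: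
  assumes "c \<in> verts G" "\<And>v. v \<in> verts G \<Longrightarrow> v \<noteq> c \<Longrightarrow> adjacent G c v"
  shows "connected_graph G"
  unfolding connected_graph_def using universal_vertex_walk[OF assms] assms(1) by (metis empty_iff)

lemma diameter_eq_2_if_universal_vertex:
  assumes "c \<in> verts G" "\<And>v. v \<in> verts G \<Longrightarrow> v \<noteq> c \<Longrightarrow> adjacent G c v"
    and "x \<in> verts G" "y \<in> verts G" "x \<noteq> y" "\<not> adjacent G x y"
  shows "diameter_of_graph G = 2"
proof (rule antisym)
  have "graph_distance G u v \<le> 2" if uv: "u \<in> verts G" "v \<in> verts G" for u v
  proof -
    obtain vs where vs: "walk_between G u v vs" "length (walk_edges vs) \<le> 2"
      using universal_vertex_walk[OF assms(1,2) uv] by blast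
    have "graph_distance G u v \<le> enat (length (walk_edges vs))"
      by (rule graph_distance_le[OF vs(1)])
    also have "\<dots> \<le> 2" using vs(2) by (simp add: numeral_eq_enat)
    finally show ?thesis .
  qed
  then show "diameter_of_graph G \<le> 2" unfolding diameter_of_graph_def by (auto intro!: Sup_least)
  have "graph_distance G x y \<le> diameter_of_graph G"
    unfolding diameter_of_graph_def using assms by (intro Sup_upper) blast
  then show "2 \<le> diameter_of_graph G"
    using graph_distance_ge_2[OF assms(5,6)] by (rule order_trans[rotated])
qed

text \<open>An edge changes sides, and going round a triangle changes sides an odd number of
  times.\<close>

lemma not_bipartite_if_triangle:
  assumes "adjacent G a b" "adjacent G b c" "adjacent G a c"
  shows "\<not> bipartite_graph G"
proof
  assume "bipartite_graph G"
  then obtain A B where "A \<inter> B = {}" and *: "\<forall>e\<in>edges G. \<exists>x\<in>A. \<exists>y\<in>B. e = {x, y}"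
    unfolding bipartite_graph_def by blast
  then have "x \<in> A \<longleftrightarrow> y \<in> B" "x \<in> B \<longleftrightarrow> y \<in> A" if "adjacent G x y" for x y
    using that unfolding adjacent_def by (fastforce simp: doubleton_eq_iff)+
  moreover obtain "x \<in> A \<or> x \<in> B" if "adjacent G x y" for x y
    using * unfolding adjacent_def by (metis doubleton_eq_iff)
  ultimately show False using assms \<open>A \<inter> B = {}\<close> by blast
qed

text \<open>A clique onto which the graph retracts by a homomorphism of simple graphs
  is simultaneously a largest clique and a set of colours.\<close>

lemma chromatic_and_clique_number:
  assumes fin: "finite (verts G)" and S: "is_clique G S" and f: "f ` verts G \<subseteq> S"
    and hom: "\<And>u v. u \<in> verts G \<Longrightarrow> v \<in> verts G \<Longrightarrow> adjacent G u v \<Longrightarrow> f u \<noteq> f v"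
  shows "chromatic_number G = card S" "clique_number G = card S"
proof -
  have "finite S" using S fin finite_subset unfolding is_clique_def by blast
  then obtain h where h: "bij_betw h S {0..<card S}" using ex_bij_betw_finite_nat by blast
  have "h (f v) < card S" if "v \<in> verts G" for v
    using bij_betwE[OF h] f that by auto
  moreover have "h (f u) \<noteq> h (f v)" if "u \<in> verts G" "v \<in> verts G" "adjacent G u v" for u v
    using inj_onD[OF bij_betw_imp_inj_on[OF h], of "f u" "f v"] hom[OF that] f that(1,2) by blast
  ultimately have col: "proper_colouring G (card S) (h \<circ> f)"
    unfolding proper_colouring_def by auto
  \<comment> \<open>Used twice: for \<open>S\<close> it bounds every colouring from below, and for
    the colouring \<open>h \<circ> f\<close> it bounds every clique from above.\<close>
  have bound: "card T \<le> k" if "is_clique G T" "proper_colouring G k d" for T k d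
  proof -
    have "inj_on d T" using that unfolding is_clique_def proper_colouring_def inj_on_def by blast
    moreover have "d ` T \<subseteq> {..<k}" using that unfolding is_clique_def proper_colouring_def by blast
    ultimately show ?thesis using card_inj_on_le[of d T "{..<k}"] by simp
  qed
  show "chromatic_number G = card S"
    unfolding chromatic_number_def using bound[OF S] col by (intro Least_equality) blast+
  have "finite {card T | T. is_clique G T}"
    by (rule finite_subset[of _ "card ` Pow (verts G)"]) (use fin in \<open>auto simp: is_clique_def\<close>)
  then show "clique_number G = card S"
    unfolding clique_number_def using bound[OF _ col] S by (intro Max_eqI) auto
qed

lemma independence_number_eqI:
  assumes fin: "finite (verts G)" and S: "is_independent G S"
    and "\<And>T. is_independent G T \<Longrightarrow> card T \<le> card S"
  shows "independence_number G = card S"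
proof -
  have "finite {card T | T. is_independent G T}"
    by (rule finite_subset[of _ "card ` Pow (verts G)"]) (use fin in \<open>auto simp: is_independent_def\<close>)
  then show ?thesis
    unfolding independence_number_def using assms by (intro Max_eqI) auto
qed

section \<open>Distances, degrees, bipartiteness and cycles modulo \<open>n\<close>\<close>

lemma zmod_one_universal:
  assumes "n \<ge> 2"
  shows "1 \<in> verts (zmod_generating_graph n)"
    and "\<And>v. v \<in> verts (zmod_generating_graph n) \<Longrightarrow> v \<noteq> 1 \<Longrightarrow> adjacent (zmod_generating_graph n) 1 v"
  using assms adjacent_zmod_unit[of 1 n] by (auto simp: verts_zmod)

lemma not_prime_factor:
  assumes "n \<ge> 2" "\<not> prime (n::nat)"
  obtains p where "prime p" "p dvd n" "p < n"
proof -
  obtain p where p: "prime p" "p dvd n" using prime_factor_nat[of n] assms by auto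
  moreover have "p \<le> n" using p assms dvd_imp_le by auto
  ultimately show ?thesis using that assms by (metis le_neq_implies_less)
qed

lemma coprime_zmod_prime:
  assumes "prime n" "0 < a" "a < int n"
  shows "coprime a (int n)"
proof -
  have "\<not> int n dvd a" using assms zdvd_not_zless by blast
  then show ?thesis using assms(1) prime_imp_coprime[of "int n" a] by (simp add: coprime_commute)
qed

text \<open>The vertex \<open>1\<close> is adjacent to all others. For composite \<open>n\<close>,
  \<open>0\<close> is not adjacent to a proper prime divisor; for prime \<open>n\<close> all nonzero
  residues are units and the graph is complete.\<close>

lemma diameter_zmod:
  assumes n: "n \<ge> 2"
  shows "\<not> prime n \<Longrightarrow> diameter_of_graph (zmod_generating_graph n) = 2"
    and "prime n \<Longrightarrow> diameter_of_graph (zmod_generating_graph n) = 1"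
proof -
  let ?G = "zmod_generating_graph n"
  have V: "verts ?G = {0..<int n}" using n by (simp add: verts_zmod)
  show "diameter_of_graph ?G = 2" if "\<not> prime n"
  proof -
    obtain p where p: "prime p" "p dvd n" "p < n" using not_prime_factor[OF n \<open>\<not> prime n\<close>] by blast
    show ?thesis
    proof (rule diameter_eq_2_if_universal_vertex[OF zmod_one_universal[OF n], of 0 "int p"])
      show "\<not> adjacent ?G 0 (int p)"
        using p n by (intro not_adjacent_zmod_common_prime[of p]) auto
    qed (use V p prime_gt_0_nat[of p] in auto)
  qed
  show "diameter_of_graph ?G = 1" if "prime n"
  proof (rule diameter_eq_1_if_complete[of ?G 0 1])
    fix u v assume uv: "u \<in> verts ?G" "v \<in> verts ?G" "u \<noteq> v"
    have "coprime w (int n)" if "w \<in> verts ?G" "w \<noteq> 0" for w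
      using that V coprime_zmod_prime[OF \<open>prime n\<close>, of w] by auto
    then show "adjacent ?G u v"
      using uv adjacent_zmod_unit[of u n v] adjacent_zmod_unit[of v n u] V
        adjacent_commute[of ?G u v] by metis
  qed (use V n in auto)
qed

text \<open>The degrees of \<open>1\<close> and \<open>0\<close> are compared: for composite
  \<open>n\<close>, \<open>0\<close> misses itself and a proper prime divisor of \<open>n\<close>,
  whereas \<open>1\<close> misses only itself.\<close>

lemma regular_zmod_iff:
  assumes n: "n \<ge> 2"
  shows "regular_graph (zmod_generating_graph n) \<longleftrightarrow> prime n"
proof
  let ?G = "zmod_generating_graph n"
  have V: "verts ?G = {0..<int n}" using n by (simp add: verts_zmod)
  have deg1: "vertex_degree ?G 1 = n - 1" using n by (intro vertex_degree_zmod_unit) auto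
  {
    assume "regular_graph ?G"
    then have deg0: "vertex_degree ?G 0 = n - 1"
      using deg1 V n unfolding regular_graph_def by force
    show "prime n"
    proof (rule ccontr)
      assume "\<not> prime n"
      then obtain p where p: "prime p" "p dvd n" "p < n" using not_prime_factor[OF n] by blast
      have "\<not> adjacent ?G 0 (int p)"
        using p n by (intro not_adjacent_zmod_common_prime[of p]) auto
      then have "{b. adjacent ?G 0 b} \<subseteq> {0..<int n} - {0, int p}"
        using n by (auto simp: adjacent_zmod_iff)
      moreover have "card ({0..<int n} - {0, int p}) = n - 2"
        using p prime_gt_0_nat[of p] n by (subst card_Diff_subset) auto
      ultimately have "vertex_degree ?G 0 \<le> n - 2"
        using n card_mono[of "{0..<int n} - {0, int p}"] by (simp add: vertex_degree_zmod)
      then show False using deg0 n by simp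
    qed
  }
  assume "prime n"
  have "vertex_degree ?G v = n - 1" if "v \<in> verts ?G" for v
  proof (cases "v = 0")
    case True
    have "{b. adjacent ?G v b} = {1..<int n}"
    proof (rule Set.set_eqI)
      fix b
      have "adjacent ?G b 0" if "b \<in> {1..<int n}"
        using that coprime_zmod_prime[OF \<open>prime n\<close>, of b] by (intro adjacent_zmod_unit) auto
      then show "b \<in> {b. adjacent ?G v b} \<longleftrightarrow> b \<in> {1..<int n}"
        using adjacent_commute[of ?G b 0] n True by (auto simp: adjacent_zmod_iff)
    qed
    then show ?thesis using n by (simp add: vertex_degree_zmod)
  next
    case False
    then show ?thesis using that V coprime_zmod_prime[OF \<open>prime n\<close>, of v]
      by (intro vertex_degree_zmod_unit) auto
  qed
  then show "regular_graph ?G" unfolding regular_graph_def by blast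
qed

lemma bipartite_zmod_iff:
  assumes n: "n \<ge> 2"
  shows "bipartite_graph (zmod_generating_graph n) \<longleftrightarrow> n = 2"
proof
  let ?G = "zmod_generating_graph n"
  show "n = 2" if "bipartite_graph ?G"
  proof (rule ccontr)
    assume "n \<noteq> 2"
    have "coprime (int n - 1) (int n)"
      using coprime_diff_one_left[of "int n"] by simp
    \<comment> \<open>For \<open>n > 2\<close> the units \<open>1\<close> and \<open>n - 1\<close>
      differ, so they form a triangle with \<open>0\<close>.\<close>
    then have "adjacent ?G 1 0" "adjacent ?G 1 (int n - 1)" "adjacent ?G (int n - 1) 0"
      using n \<open>n \<noteq> 2\<close> by (auto intro!: adjacent_zmod_unit)
    then show False
      using not_bipartite_if_triangle[of ?G 1 "int n - 1" 0] that by blast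
  qed
  have n0: "n > 0" using n by simp
  assume "n = 2"
  then have "verts ?G = {0} \<union> {1}" by (auto simp: verts_zmod)
  moreover have "e = {0, 1}" if e: "e \<in> edges ?G" for e
  proof -
    obtain a b where "e = {a, b}" "adjacent ?G a b"
      using e unfolding edges_zmod[OF n0] by blast
    moreover from this have "a \<in> {0, 1}" "b \<in> {0, 1}" "a \<noteq> b"
      using \<open>n = 2\<close> by (auto simp: adjacent_zmod_iff)
    ultimately show ?thesis by auto
  qed
  ultimately show "bipartite_graph ?G"
    unfolding bipartite_graph_def by (intro exI[of _ "{0}"] exI[of _ "{1}"]) auto
qed

text \<open>Lets the edges of an explicitly listed cycle be checked index by index.\<close>

lemma set_walk_edges: "set (walk_edges vs) = {{vs ! i, vs ! Suc i} | i. Suc i < length vs}"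
proof (induction vs rule: induct_list012)
  case (3 x y zs)
  have "{{(x # y # zs) ! i, (x # y # zs) ! Suc i} | i. Suc i < length (x # y # zs)} =
      insert {x, y} {{(y # zs) ! i, (y # zs) ! Suc i} | i. Suc i < length (y # zs)}"
    (is "?L = ?R")
  proof
    show "?L \<subseteq> ?R"
    proof
      fix e assume "e \<in> ?L"
      then obtain i where "e = {(x # y # zs) ! i, (x # y # zs) ! Suc i}" "Suc i < length (x # y # zs)"
        by blast
      then show "e \<in> ?R" by (cases i) auto
    qed
    have "{x, y} \<in> ?L" by (rule CollectI, rule exI[of _ 0]) simp
    moreover have "{(y # zs) ! i, (y # zs) ! Suc i} \<in> ?L" if "Suc i < length (y # zs)" for i
      using that by (intro CollectI exI[of _ "Suc i"]) simp
    ultimately show "?R \<subseteq> ?L" by blast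
  qed
  then show ?case using 3 by (simp only: walk_edges_Cons_Cons list.set)
qed simp_all

lemma hamiltonian_zmod:
  assumes n: "n > 2"
  shows "hamiltonian_graph (zmod_generating_graph n)"
proof -
  let ?G = "zmod_generating_graph n"
  define vs where "vs = [0..int n - 1]"
  have len: "length vs = n" by (simp add: vs_def)
  have nth: "vs ! i = int i" if "i < n" for i using that by (simp add: vs_def)
  have set: "set vs = verts ?G" using n by (auto simp: vs_def verts_zmod)
  have step: "adjacent ?G (int i) (int (Suc i))" if "Suc i < n" for i
  proof -
    have "coprime (int i) (int (Suc i))" unfolding coprime_int_iff by simp
    then have "gcd (int i) (int (Suc i)) = 1" by simp
    then show ?thesis using that by (simp add: adjacent_zmod_iff del: of_nat_Suc)
  qed
  have "adjacent ?G (int n - 1) 0"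
    using n coprime_diff_one_left[of "int n"] by (intro adjacent_zmod_unit) auto
  moreover have "vs \<noteq> []" using len n by auto
  moreover from this have "hd vs = 0" "last vs = int n - 1"
    using nth[of 0] nth[of "n - 1"] len n by (simp_all add: hd_conv_nth last_conv_nth of_nat_diff)
  moreover have "set (walk_edges vs) \<subseteq> edges ?G"
    using step by (auto simp: set_walk_edges len nth adjacent_def)
  ultimately show ?thesis
    unfolding hamiltonian_graph_def using set len n
    by (intro exI[of _ vs]) (simp add: is_walk_def vs_def)
qed

lemma eulerian_zmod_iff:
  assumes n: "n \<ge> 2"
  shows "eulerian_graph (zmod_generating_graph n) \<longleftrightarrow> odd n"
proof -
  let ?G = "zmod_generating_graph n"
  have V: "verts ?G = {0..<int n}" using n by (simp add: verts_zmod)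
  have edge: "e \<subseteq> verts ?G \<and> card e = 2" if "e \<in> edges ?G" for e
    using that n by (auto simp: edges_zmod adjacent_zmod_iff V)
  have "edges ?G \<subseteq> Pow (verts ?G)" using edge by blast
  then have fin: "finite (edges ?G)" using V finite_subset by fastforce
  have "eulerian_graph ?G \<longleftrightarrow> (\<forall>v\<in>verts ?G. even (vertex_degree ?G v))"
    by (rule eulerian_iff_even_degrees[OF connected_if_universal_vertex fin edge])
      (use zmod_one_universal[OF n] in blast)+
  also have "\<dots> \<longleftrightarrow> odd n"
  proof
    assume "\<forall>v\<in>verts ?G. even (vertex_degree ?G v)"
    \<comment> \<open>The degree of a single unit already forces the parity of
      \<open>n\<close>.\<close>
    moreover have "vertex_degree ?G 1 = n - 1" using n by (intro vertex_degree_zmod_unit) auto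
    ultimately have "even (n - 1)" using zmod_one_universal(1)[OF n] by metis
    then show "odd n" using n by simp
  next
    assume "odd n"
    then show "\<forall>v\<in>verts ?G. even (vertex_degree ?G v)"
      unfolding V using even_vertex_degree_zmod by blast
  qed
  finally show ?thesis .
qed

section \<open>Cliques, colourings and independent sets modulo \<open>n\<close>\<close>

text \<open>\<open>totatives n\<close> ranges over numbers from \<open>1\<close> to
  \<open>n\<close>, the vertices from \<open>0\<close> to \<open>n - 1\<close>; for
  \<open>n \<ge> 2\<close> neither \<open>0\<close> nor \<open>n\<close> is coprime to
  \<open>n\<close>.\<close>

lemma card_units_zmod:
  assumes "n \<ge> 2"
  shows "card {a \<in> {0..<int n}. coprime a (int n)} = totient n"
proof -
  have "{a \<in> {0..<int n}. coprime a (int n)} = int ` totatives n"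
  proof (rule subset_antisym; rule subsetI)
    fix a assume a: "a \<in> {a \<in> {0..<int n}. coprime a (int n)}"
    then have "a \<noteq> 0" using assms by auto
    moreover have "coprime (nat a) n" by (subst coprime_int_iff[symmetric]) (use a in simp)
    ultimately have "nat a \<in> totatives n" using a by (auto simp: totatives_def)
    then show "a \<in> int ` totatives n" using a by (intro image_eqI[of _ _ "nat a"]) auto
  next
    fix a assume "a \<in> int ` totatives n"
    then show "a \<in> {a \<in> {0..<int n}. coprime a (int n)}"
      using assms totatives_less by (auto simp: totatives_def)
  qed
  then show ?thesis by (simp add: totient_def card_image)
qed

lemma chromatic_and_clique_number_zmod:
  assumes n: "n \<ge> 2"
  shows "chromatic_number (zmod_generating_graph n) = totient n + prime_omega n"
    and "clique_number (zmod_generating_graph n) = totient n + prime_omega n"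
proof -
  let ?G = "zmod_generating_graph n"
  have n0: "n > 0" using n by simp
  have V: "verts ?G = {0..<int n}" using n by (simp add: verts_zmod)
  define U where "U = {a \<in> {0..<int n}. coprime a (int n)}"
  \<comment> \<open>The reduction matters only for prime \<open>n\<close>, whose prime factor
    \<open>n\<close> becomes the vertex \<open>0\<close>.\<close>
  define h where "h p = int p mod int n" for p
  define S where "S = U \<union> h ` prime_factors n"
  have dvd_h: "int r dvd h p \<longleftrightarrow> r dvd p" if "r dvd n" for r p
    using that by (simp add: h_def dvd_mod_iff)
  have h_not_unit: "\<not> coprime (h p) (int n)" if "p \<in> prime_factors n" for p
    using that dvd_h[of p p] prime_gt_1_nat[of p]
    by (intro not_coprimeI[of "int p"]) (auto simp: in_prime_factors_iff)
  \<comment> \<open>The only prime factor of \<open>n\<close> that divides \<open>h p\<close> is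
    \<open>p\<close>. Both the injectivity of \<open>h\<close> and the adjacency of distinct values
    of \<open>h\<close> rest on this.\<close>
  have common: "r = p" if "r \<in> prime_factors n" "p \<in> prime_factors n" "int r dvd h p" for r p
    using that by (metis dvd_h in_prime_factors_iff primes_dvd_imp_eq)
  have inj: "inj_on h (prime_factors n)"
  proof (rule inj_onI)
    fix p q assume pq: "p \<in> prime_factors n" "q \<in> prime_factors n" "h p = h q"
    then have "int p dvd h q" using dvd_h[of p p] by (auto simp: in_prime_factors_iff)
    then show "p = q" using common pq by blast
  qed
  have "finite U" by (rule finite_subset[of _ "{0..<int n}"]) (auto simp: U_def)
  then have "card S = card U + card (h ` prime_factors n)"
    unfolding S_def using h_not_unit by (intro card_Un_disjoint) (auto simp: U_def)
  then have card: "card S = totient n + prime_omega n"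
    using card_units_zmod[OF n] inj by (simp add: U_def card_image prime_omega_def)
  have "adjacent ?G a b" if ab: "a \<in> S" "b \<in> S" "a \<noteq> b" for a b
  proof -
    have range: "a \<in> {0..<int n}" "b \<in> {0..<int n}"
      using ab n by (auto simp: S_def U_def h_def)
    consider "coprime a (int n)" | "coprime b (int n)"
      | p q where "p \<in> prime_factors n" "q \<in> prime_factors n" "a = h p" "b = h q"
      using ab by (auto simp: S_def U_def)
    then show ?thesis
    proof cases
      case 1
      then show ?thesis using range ab by (intro adjacent_zmod_unit)
    next
      case 2
      then show ?thesis using range ab adjacent_zmod_unit[of b n a] adjacent_commute[of ?G a b] by auto
    next
      case 3
      have "coprime (gcd a b) (int n)"
      proof (rule ccontr)
        assume "\<not> coprime (gcd a b) (int n)"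
        then obtain r where "r \<in> prime_factors n" "int r dvd gcd a b"
          using not_coprime_int_prime_factor[OF _ n0] by blast
        then have "r = p" "r = q" using common 3 by auto
        then show False using 3 ab by simp
      qed
      then show ?thesis using range ab n by (subst adjacent_zmod_iff) auto
    qed
  qed
  moreover have "h p \<in> {0..<int n}" for p using n by (simp add: h_def)
  then have "S \<subseteq> verts ?G" unfolding V S_def U_def by blast
  ultimately have clique: "is_clique ?G S" unfolding is_clique_def by blast
  have "\<forall>a. \<exists>p. \<not> coprime a (int n) \<longrightarrow> p \<in> prime_factors n \<and> int p dvd a"
    using not_coprime_int_prime_factor[OF _ n0] by blast
  then obtain g where g: "\<And>a. \<not> coprime a (int n) \<Longrightarrow> g a \<in> prime_factors n \<and> int (g a) dvd a"
    by metis
  \<comment> \<open>Units get colours of their own, and a non-unit gets a chosen prime shared with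
    \<open>n\<close>. Two non-units of equal colour thus have a common prime and are not
    adjacent.\<close>
  define f where "f a = (if coprime a (int n) then a else h (g a))" for a
  have fS: "f ` verts ?G \<subseteq> S" using g V by (auto simp: f_def S_def U_def)
  have hom: "f u \<noteq> f v" if "adjacent ?G u v" for u v
  proof
    assume eq: "f u = f v"
    have ne: "u \<noteq> v" using that n by (simp add: adjacent_zmod_iff)
    consider "coprime u (int n)" "coprime v (int n)" | "coprime u (int n)" "\<not> coprime v (int n)"
      | "\<not> coprime u (int n)" "coprime v (int n)" | "\<not> coprime u (int n)" "\<not> coprime v (int n)" by blast
    then show False
    proof cases
      case 1
      then show False using eq ne by (simp add: f_def)
    next
      case 2
      then show False using eq h_not_unit[of "g v"] g[of v] by (simp add: f_def)
    next
      case 3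
      then show False using eq h_not_unit[of "g u"] g[of u] by (simp add: f_def)
    next
      case 4
      then have "h (g u) = h (g v)" using eq by (simp add: f_def)
      then have "g u = g v" using inj_onD[OF inj] g 4 by blast
      then have "int (g u) dvd u" "int (g u) dvd v" "g u dvd n" "\<not> is_unit (g u)"
        using g[OF 4(1)] g[OF 4(2)] by (auto simp: in_prime_factors_iff)
      then show False using not_adjacent_zmod_common_prime[of "g u" n u v] that n by simp
    qed
  qed
  show "chromatic_number ?G = totient n + prime_omega n" "clique_number ?G = totient n + prime_omega n"
    using chromatic_and_clique_number[OF _ clique fS hom] V card by auto
qed

lemma independence_number_zmod:
  assumes n: "n \<ge> 2"
  shows "independence_number (zmod_generating_graph n) = n div Min (prime_factors n)"
proof -
  let ?G = "zmod_generating_graph n"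
  define p where "p = Min (prime_factors n)"
  have n0: "n > 0" using n by simp
  have V: "verts ?G = {0..<int n}" using n by (simp add: verts_zmod)
  have "prime_factors n \<noteq> {}"
    using n prime_factor_nat[of n] in_prime_factors_iff[of _ n] by fastforce
  then have "p \<in> prime_factors n" unfolding p_def by (intro Min_in) auto
  then have p: "prime p" "p dvd n" by (auto simp: in_prime_factors_iff)
  have p_least: "p \<le> r" if "r \<in> prime_factors n" for r unfolding p_def using that by simp
  have p0: "p > 0" using p(1) prime_gt_0_nat by blast
  define m where "m = n div p"
  have nm: "n = p * m" using p(2) by (simp add: m_def)
  define S where "S = (\<lambda>k. int p * int k) ` {..<m}"
  have cardS: "card S = m"
    unfolding S_def using p0 by (subst card_image) (auto simp: inj_on_def)
  have "int p * int k < int n" if "k < m" for k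
    using that p0 unfolding nm of_nat_mult by simp
  then have "S \<subseteq> verts ?G" unfolding V S_def by auto
  moreover have "\<not> adjacent ?G u v" if "u \<in> S" "v \<in> S" for u v
    using that p n by (intro not_adjacent_zmod_common_prime[of p]) (auto simp: S_def)
  ultimately have ind: "is_independent ?G S" by (simp add: is_independent_def)
  have "card T \<le> card S" if T: "is_independent ?G T" for T
  proof -
    have TV: "T \<subseteq> {0..<int n}" using T V by (simp add: is_independent_def)
    \<comment> \<open>The quotient names the block of \<open>p\<close> consecutive numbers. Distinct
      members of a block differ by less than \<open>p\<close>, the least prime factor, so no prime
      factor of \<open>n\<close> divides both and they are adjacent.\<close>
    have "inj_on (\<lambda>a. a div int p) T"
    proof (rule inj_onI, rule ccontr)
      fix a b assume ab: "a \<in> T" "b \<in> T" "a div int p = b div int p" "a \<noteq> b"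
      have "a - b = a mod int p - b mod int p"
        using ab(3) by (metis add_diff_cancel_left mult_div_mod_eq)
      moreover have "0 \<le> a mod int p" "a mod int p < int p" "0 \<le> b mod int p" "b mod int p < int p"
        using p0 by simp_all
      ultimately have small: "\<bar>a - b\<bar> < int p" by linarith
      have "coprime (gcd a b) (int n)"
      proof (rule ccontr)
        assume "\<not> coprime (gcd a b) (int n)"
        then obtain r where r: "r \<in> prime_factors n" "int r dvd gcd a b"
          using not_coprime_int_prime_factor[OF _ n0] by blast
        then have "int r dvd a - b" by auto
        then have "int r \<le> \<bar>a - b\<bar>" using ab(4) by (intro zdvd_imp_le) auto
        then show False using small p_least[OF r(1)] by linarith
      qed
      then have "adjacent ?G a b" using ab TV n by (subst adjacent_zmod_iff) auto
      then show False using T ab by (auto simp: is_independent_def)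
    qed
    moreover have "(\<lambda>a. a div int p) ` T \<subseteq> {0..<int m}"
    proof
      fix x assume "x \<in> (\<lambda>a. a div int p) ` T"
      then obtain a where a: "a \<in> T" "x = a div int p" by blast
      then have "0 \<le> a" and "a < int m * int p" using TV nm by (auto simp: mult.commute)
      moreover have "int p * (a div int p) \<le> a"
        using mult_div_mod_eq[of "int p" a] pos_mod_sign[of "int p" a] p0 by linarith
      ultimately have "int p * (a div int p) < int p * int m" by (simp add: mult.commute)
      then show "x \<in> {0..<int m}"
        using a(2) p0 \<open>0 \<le> a\<close> by (simp add: pos_imp_zdiv_nonneg_iff)
    qed
    ultimately show ?thesis
      using card_inj_on_le[of "\<lambda>a. a div int p" T "{0..<int m}"] cardS by simp
  qed
  then show ?thesis
    using independence_number_eqI[OF _ ind] V cardS by (simp add: m_def p_def)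
qed

section \<open>Cliques of five vertices modulo \<open>n\<close>\<close>

text \<open>For odd \<open>n\<close> take \<open>2\<close>. For \<open>n = 2 * m\<close> take the
  odd number \<open>m - 1\<close> or \<open>m - 2\<close>, according to the parity of
  \<open>m\<close>; it is coprime to \<open>m\<close> because a common divisor divides
  \<open>1\<close> or is an odd divisor of \<open>2\<close>.\<close>

lemma obtain_unit_less_half:
  fixes n :: nat
  assumes "n \<ge> 2" "n \<notin> {2, 3, 4, 6}"
  obtains u where "coprime u n" "1 < u" "2 * u < n"
proof (cases "even n")
  case False
  then have "n \<noteq> 2" "n \<noteq> 4" by auto
  with assms have "n \<ge> 5" by auto
  then show ?thesis using that[of 2] False by simp
next
  case True
  then obtain m where m: "n = 2 * m" by blast
  then have "m \<ge> 4" using assms by auto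
  show ?thesis
  proof (cases "even m")
    case True
    have "coprime (m - 1) m" using \<open>m \<ge> 4\<close> coprime_diff_one_left_nat[of m] by simp
    moreover have "odd (m - 1)" using True \<open>m \<ge> 4\<close> by simp
    ultimately have "coprime (m - 1) n" unfolding m by simp
    then show ?thesis using that[of "m - 1"] \<open>m \<ge> 4\<close> m by simp
  next
    case False
    have odd: "odd (m - 2)" using False \<open>m \<ge> 4\<close> by simp
    have "gcd (m - 2) m dvd m - (m - 2)" by (rule dvd_diff_nat) simp_all
    also have "m - (m - 2) = 2" using \<open>m \<ge> 4\<close> by simp
    finally have "gcd (m - 2) m dvd 2" .
    moreover have "odd (gcd (m - 2) m)" using odd by (meson dvd_trans gcd_dvd1)
    ultimately have "coprime (m - 2) m"
      by (metis coprime_iff_gcd_eq_1 dvd_refl prime_nat_iff two_is_prime_nat)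
    then have "coprime (m - 2) n" unfolding m using odd by simp
    moreover have "m \<noteq> 4" using False by auto
    ultimately show ?thesis using that[of "m - 2"] \<open>m \<ge> 4\<close> m by simp
  qed
qed

lemma zmod_clique_5:
  assumes n: "n \<ge> 2" "n \<notin> {2, 3, 4, 6}"
  obtains K where "is_clique (zmod_generating_graph n) K" "card K = 5"
proof -
  let ?G = "zmod_generating_graph n"
  obtain u where u: "coprime u n" "1 < u" "2 * u < n" using obtain_unit_less_half[OF n] by blast
  define K where "K = {0, 1, int u, int n - int u, int n - 1}"
  have unit: "coprime x (int n)" if "x \<in> K" "x \<noteq> 0" for x
  proof -
    have "coprime (int n - y) (int n)" if "coprime y (int n)" for y
      using that gcd_diff2[of "int n" y] unfolding coprime_iff_gcd_eq_1 by (simp add: gcd.commute)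
    then show ?thesis using that u(1) by (auto simp: K_def coprime_int_iff)
  qed
  have KV: "K \<subseteq> {0..<int n}" using u by (auto simp: K_def)
  have "adjacent ?G x y" if "x \<in> K" "y \<in> K" "x \<noteq> y" for x y
  proof (cases "x = 0")
    case True
    then show ?thesis
      using that KV unit[of y] adjacent_zmod_unit[of y n x] adjacent_commute[of ?G x y] by auto
  next
    case False
    then show ?thesis using that KV unit[of x] by (intro adjacent_zmod_unit) auto
  qed
  then have "is_clique ?G K" using KV n by (simp add: is_clique_def verts_zmod)
  \<comment> \<open>The bounds on \<open>u\<close> give
    \<open>0 < 1 < u < n - u < n - 1\<close>.\<close>
  moreover have "card K = 5" using u by (simp add: K_def)
  ultimately show ?thesis using that by blast
qed

section \<open>Straight-line drawings\<close>

text \<open>Only one inclusion of each incidence condition has to be assumed, since a segment always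
  contains its endpoints.\<close>

lemma planar_if_straight_line_drawing:
  fixes p :: "'a \<Rightarrow> complex"
  assumes inj: "inj_on p (verts G)"
    and edges: "\<And>e. e \<in> edges G \<Longrightarrow> e \<subseteq> verts G \<and> card e = 2"
    and vertex: "\<And>e. e \<in> edges G \<Longrightarrow> convex hull (p ` e) \<inter> p ` verts G \<subseteq> p ` e"
    and cross: "\<And>e f. e \<in> edges G \<Longrightarrow> f \<in> edges G \<Longrightarrow> e \<noteq> f \<Longrightarrow>
      convex hull (p ` e) \<inter> convex hull (p ` f) \<subseteq> p ` (e \<inter> f)"
  shows "planar_graph G"
proof -
  have "\<exists>g. arc g \<and> {pathstart g, pathfinish g} = p ` e \<and> path_image g = convex hull (p ` e)"
    if e: "e \<in> edges G" for e
  proof -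
    obtain a b where ab: "e = {a, b}" "a \<noteq> b" using edges[OF e] by (auto simp: card_2_iff)
    then have "p a \<noteq> p b" using inj edges[OF e] by (auto simp: inj_on_def)
    then show ?thesis unfolding ab(1)
      by (intro exI[of _ "linepath (p a) (p b)"]) (simp add: segment_convex_hull)
  qed
  then obtain \<gamma> where \<gamma>: "\<And>e. e \<in> edges G \<Longrightarrow> arc (\<gamma> e) \<and>
      {pathstart (\<gamma> e), pathfinish (\<gamma> e)} = p ` e \<and> path_image (\<gamma> e) = convex hull (p ` e)"
    by metis
  have hull: "p ` e \<subseteq> convex hull (p ` e)" for e by (rule hull_subset)
  have "convex hull (p ` e) \<inter> p ` verts G = p ` e" if "e \<in> edges G" for e
    using vertex[OF that] hull[of e] edges[OF that] by blast
  moreover have "convex hull (p ` e) \<inter> convex hull (p ` f) = p ` (e \<inter> f)"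
    if "e \<in> edges G" "f \<in> edges G" "e \<noteq> f" for e f
    using cross[OF that] hull[of e] hull[of f] by blast
  ultimately have "plane_drawing G p \<gamma>"
    unfolding plane_drawing_def using inj \<gamma> by simp
  then show ?thesis unfolding planar_graph_def by blast
qed

text \<open>Each edge of \<open>G\<close> is drawn by the arc of its image in \<open>H\<close>, so
  one drawing serves for all subgraphs.\<close>

lemma planar_if_embeds:
  assumes planar: "planar_graph H" and inj: "inj_on f (verts G)" and f: "f ` verts G \<subseteq> verts H"
    and edges: "\<And>e. e \<in> edges G \<Longrightarrow> e \<subseteq> verts G \<and> f ` e \<in> edges H"
  shows "planar_graph G"
proof -
  obtain p \<gamma> where dr: "plane_drawing H p \<gamma>" using planar unfolding planar_graph_def by blast
  have inj_p: "inj_on p (verts H)"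
    and arcs: "\<And>e. e \<in> edges H \<Longrightarrow> arc (\<gamma> e) \<and> {pathstart (\<gamma> e), pathfinish (\<gamma> e)} = p ` e"
    and vertex: "\<And>e. e \<in> edges H \<Longrightarrow> path_image (\<gamma> e) \<inter> p ` verts H = p ` e"
    and cross: "\<And>e e'. e \<in> edges H \<Longrightarrow> e' \<in> edges H \<Longrightarrow> e \<noteq> e' \<Longrightarrow>
      path_image (\<gamma> e) \<inter> path_image (\<gamma> e') = p ` (e \<inter> e')"
    using dr unfolding plane_drawing_def by simp_all
  have inj_pf: "inj_on (p \<circ> f) (verts G)" using comp_inj_on[OF inj inj_on_subset[OF inj_p f]] .
  have vertex_pf: "path_image (\<gamma> (f ` e)) \<inter> (p \<circ> f) ` verts G = (p \<circ> f) ` e" if e: "e \<in> edges G" for e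
  proof -
    have "path_image (\<gamma> (f ` e)) \<inter> p ` verts H = p ` f ` e"
      using vertex edges[OF e] by blast
    moreover have "X \<inter> C = E" if "X \<inter> D = E" "E \<subseteq> C" "C \<subseteq> D" for X C D E :: "complex set"
      using that by blast
    moreover have "p ` f ` e \<subseteq> p ` f ` verts G" using edges[OF e] by (intro image_mono) simp
    moreover have "p ` f ` verts G \<subseteq> p ` verts H" using f by (rule image_mono)
    ultimately show ?thesis unfolding image_comp[symmetric] by metis
  qed
  have cross_pf: "path_image (\<gamma> (f ` e)) \<inter> path_image (\<gamma> (f ` e')) = (p \<circ> f) ` (e \<inter> e')"
    if e: "e \<in> edges G" "e' \<in> edges G" "e \<noteq> e'" for e e'
  proof -
    note sub = edges[OF e(1), THEN conjunct1] edges[OF e(2), THEN conjunct1]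
    have "f ` e \<noteq> f ` e'" using inj_on_image_eq_iff[OF inj sub] e(3) by blast
    then have "path_image (\<gamma> (f ` e)) \<inter> path_image (\<gamma> (f ` e')) = p ` (f ` e \<inter> f ` e')"
      using cross edges[OF e(1)] edges[OF e(2)] by blast
    then show ?thesis by (simp only: image_comp[symmetric] inj_on_image_Int[OF inj sub])
  qed
  have arcs_pf: "arc (\<gamma> (f ` e)) \<and> {pathstart (\<gamma> (f ` e)), pathfinish (\<gamma> (f ` e))} = (p \<circ> f) ` e"
    if "e \<in> edges G" for e
    unfolding image_comp[symmetric] by (rule arcs[OF conjunct2[OF edges[OF that]]])
  have "plane_drawing G (p \<circ> f) (\<lambda>e. \<gamma> (f ` e))"
    unfolding plane_drawing_def
    by (intro conjI ballI impI inj_pf vertex_pf cross_pf arcs_pf[THEN conjunct1] arcs_pf[THEN conjunct2])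
  then show ?thesis unfolding planar_graph_def by blast
qed

text \<open>Here \<open>s\<close> selects the upper or lower apex. Linear conditions on the
  coordinates reduce the crossing checks to linear arithmetic.\<close>

lemma segment_apex_to_axis:
  fixes k s :: real
  assumes "s = 1 \<or> s = -1"
  shows "convex hull {Complex 0 s, Complex k 0} =
    {z. 0 \<le> s * Im z \<and> s * Im z \<le> 1 \<and> Re z = k * (1 - s * Im z)}"
proof -
  have "z \<in> closed_segment (Complex 0 s) (Complex k 0) \<longleftrightarrow>
      0 \<le> s * Im z \<and> s * Im z \<le> 1 \<and> Re z = k * (1 - s * Im z)" for z
  proof
    assume "z \<in> closed_segment (Complex 0 s) (Complex k 0)"
    then show "0 \<le> s * Im z \<and> s * Im z \<le> 1 \<and> Re z = k * (1 - s * Im z)"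
      using assms by (auto simp: in_segment)
  next
    assume "0 \<le> s * Im z \<and> s * Im z \<le> 1 \<and> Re z = k * (1 - s * Im z)"
    then show "z \<in> closed_segment (Complex 0 s) (Complex k 0)"
      using assms unfolding in_segment
      \<comment> \<open>At parameter \<open>t\<close> the point has imaginary part
        \<open>(1 - t) * s\<close>, and the square of \<open>s\<close> is \<open>1\<close>.\<close>
      by (intro exI[of _ "1 - s * Im z"]) (auto simp: complex_eq_iff)
  qed
  then show ?thesis by (auto simp: segment_convex_hull)
qed

lemma segment_on_axis:
  fixes a b :: real
  assumes "a \<le> b"
  shows "convex hull {Complex a 0, Complex b 0} = {z. Im z = 0 \<and> a \<le> Re z \<and> Re z \<le> b}"
  using closed_segment_same_Im[of "Complex a 0" "Complex b 0"] closed_segment_eq_real_ivl[of a b] assms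
  by (auto simp: segment_convex_hull)

lemma segment_apices: "convex hull {Complex 0 1, Complex 0 (-1)} = {z. Re z = 0 \<and> -1 \<le> Im z \<and> Im z \<le> 1}"
  using closed_segment_same_Re[of "Complex 0 1" "Complex 0 (-1)"] closed_segment_eq_real_ivl[of 1 "-1"]
  by (auto simp: segment_convex_hull)

text \<open>This is the generating graph for \<open>n = 6\<close>; those for \<open>n = 2, 3, 4\<close> embed into it.\<close>

definition fan :: "int sgraph" where
  "fan = \<lparr>verts = {0, 1, 2, 3, 4, 5},
     edges = {{1, 5}, {1, 0}, {1, 2}, {1, 3}, {1, 4}, {5, 0}, {5, 2}, {5, 3}, {5, 4}, {2, 3}, {3, 4}}\<rparr>"

text \<open>The units \<open>1\<close> and \<open>5\<close> modulo \<open>6\<close> are the apices;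
  \<open>0\<close>, \<open>2\<close>, \<open>3\<close>, \<open>4\<close> lie on the real axis at
  \<open>-1\<close>, \<open>1\<close>, \<open>2\<close>, \<open>3\<close>. The origin stays free for
  the edge between the apices, and the edges \<open>{2, 3}\<close> and \<open>{3, 4}\<close> join
  neighbours on the axis.\<close>

definition fan_point :: "int \<Rightarrow> complex" where
  "fan_point v = (if v = 1 then Complex 0 1 else if v = 5 then Complex 0 (-1)
     else if v = 0 then Complex (-1) 0 else Complex (real_of_int v - 1) 0)"

lemma planar_fan: "planar_graph fan"
proof (rule planar_if_straight_line_drawing[of fan_point])
  have apex: "convex hull {Complex 0 1, Complex k 0} = {z. 0 \<le> Im z \<and> Im z \<le> 1 \<and> Re z = k * (1 - Im z)}"
      "convex hull {Complex 0 (-1), Complex k 0} = {z. Im z \<le> 0 \<and> -1 \<le> Im z \<and> Re z = k * (1 + Im z)}" for k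
    using segment_apex_to_axis[of 1 k] segment_apex_to_axis[of "-1" k] by auto
  \<comment> \<open>Segments with an apex are described for both orders of their endpoints, so that
    the rewriting applies to either.\<close>
  note hulls = segment_apices segment_apices[unfolded insert_commute[of "Complex 0 1"]]
    segment_on_axis apex apex[unfolded insert_commute[of _ "Complex _ 0"]]
  show "inj_on fan_point (verts fan)"
    by (auto simp: inj_on_def fan_def fan_point_def)
  show "e \<subseteq> verts fan \<and> card e = 2" if "e \<in> edges fan" for e
    using that by (auto simp: fan_def)
  have "\<forall>e\<in>edges fan. \<forall>v\<in>verts fan. fan_point v \<in> convex hull (fan_point ` e) \<longrightarrow> v \<in> e"
    by (simp add: fan_def fan_point_def hulls)
  then show "convex hull (fan_point ` e) \<inter> fan_point ` verts fan \<subseteq> fan_point ` e"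
    if "e \<in> edges fan" for e
    using that by blast
  \<comment> \<open>Over the explicit list of edges this unfolds into finitely many linear
    conditions on \<open>Re z\<close> and \<open>Im z\<close>.\<close>
  have "\<forall>e\<in>edges fan. \<forall>f\<in>edges fan. e \<noteq> f \<longrightarrow>
      (\<forall>z. z \<in> convex hull (fan_point ` e) \<and> z \<in> convex hull (fan_point ` f) \<longrightarrow> z \<in> fan_point ` (e \<inter> f))"
    by (simp add: fan_def fan_point_def hulls complex_eq_iff Int_insert_left doubleton_eq_iff)
  then show "convex hull (fan_point ` e) \<inter> convex hull (fan_point ` f) \<subseteq> fan_point ` (e \<inter> f)"
    if "e \<in> edges fan" "f \<in> edges fan" "e \<noteq> f" for e f
    using that by blast
qed

lemma planar_zmod:
  assumes "n \<in> {2, 3, 4, 6}"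
  shows "planar_graph (zmod_generating_graph n)"
proof (rule planar_if_embeds[OF planar_fan])
  let ?G = "zmod_generating_graph n"
  \<comment> \<open>The unit \<open>n - 1\<close> goes to the apex \<open>5\<close>. For
    \<open>n = 2\<close> it equals \<open>1\<close>, which already is an apex.\<close>
  define f where "f v = (if v = int n - 1 \<and> n \<noteq> 2 then 5 else v)" for v
  have n: "n > 0" using assms by auto
  have V: "verts ?G = {0..<int n}" using n by (simp add: verts_zmod)
  have "n \<le> 6" using assms by auto
  show "inj_on f (verts ?G)"
  proof (rule inj_onI)
    fix v w assume "v \<in> verts ?G" "w \<in> verts ?G" and eq: "f v = f w"
    then have "v < int n" "w < int n" "int n \<le> 6" using \<open>n \<le> 6\<close> unfolding V by auto
    then show "v = w" using eq unfolding f_def by (smt (verit))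
  qed
  show "f ` verts ?G \<subseteq> verts fan"
  proof (rule image_subsetI)
    fix x assume "x \<in> verts ?G"
    then have "0 \<le> x" "x \<le> 5" using \<open>n \<le> 6\<close> unfolding V by auto
    then have "x = 0 \<or> x = 1 \<or> x = 2 \<or> x = 3 \<or> x = 4 \<or> x = 5" by presburger
    then show "f x \<in> verts fan" unfolding fan_def f_def by (elim disjE) simp_all
  qed
  fix e assume "e \<in> edges ?G"
  then obtain a b where e: "e = {a, b}" and adj: "adjacent ?G a b" unfolding edges_zmod[OF n] by blast
  have ab: "a \<in> {0..<int n}" "b \<in> {0..<int n}" "a \<noteq> b" using adj n by (auto simp: adjacent_zmod_iff)
  \<comment> \<open>For \<open>n = 4\<close> and \<open>n = 6\<close> the primes \<open>2\<close>
    and \<open>3\<close> are the only obstructions to adjacency.\<close>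
  have no2: "\<not> (even n \<and> even a \<and> even b)" and no3: "\<not> (3 dvd n \<and> 3 dvd a \<and> 3 dvd b)"
    using not_adjacent_zmod_common_prime[of 2 n a b] not_adjacent_zmod_common_prime[of 3 n a b] adj n
    by auto
  have ivl: "{0..<2} = {0, 1::int}" "{0..<3} = {0, 1, 2::int}" "{0..<4} = {0, 1, 2, 3::int}"
    "{0..<6} = {0, 1, 2, 3, 4, 5::int}"
    by auto
  consider "n = 2" | "n = 3" | "n = 4" | "n = 6" using assms by blast
  then have "{f a, f b} \<in> edges fan"
  proof cases
    case 1
    have "\<forall>a\<in>{0, 1}. \<forall>b\<in>{0, 1}. a \<noteq> b \<longrightarrow> {f a, f b} \<in> edges fan"
      using 1 by (simp add: f_def fan_def doubleton_eq_iff)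
    then show ?thesis using 1 ab ivl(1) by (metis of_nat_numeral)
  next
    case 2
    have "\<forall>a\<in>{0, 1, 2}. \<forall>b\<in>{0, 1, 2}. a \<noteq> b \<longrightarrow> {f a, f b} \<in> edges fan"
      using 2 by (simp add: f_def fan_def doubleton_eq_iff)
    then show ?thesis using 2 ab ivl(2) by (metis of_nat_numeral)
  next
    case 3
    have "\<forall>a\<in>{0, 1, 2, 3}. \<forall>b\<in>{0, 1, 2, 3}. a \<noteq> b \<longrightarrow> \<not> (even a \<and> even b) \<longrightarrow> {f a, f b} \<in> edges fan"
      using 3 by (simp add: f_def fan_def doubleton_eq_iff)
    moreover have "a \<in> {0, 1, 2, 3}" "b \<in> {0, 1, 2, 3}" using 3 ab(1,2) ivl(3) by (metis of_nat_numeral)+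
    moreover have "\<not> (even a \<and> even b)" using 3 no2 by simp
    ultimately show ?thesis using ab(3) by blast
  next
    case 4
    have "\<forall>a\<in>{0, 1, 2, 3, 4, 5}. \<forall>b\<in>{0, 1, 2, 3, 4, 5}. a \<noteq> b \<longrightarrow> \<not> (even a \<and> even b) \<longrightarrow>
        \<not> (3 dvd a \<and> 3 dvd b) \<longrightarrow> {f a, f b} \<in> edges fan"
      using 4 by (simp add: f_def fan_def doubleton_eq_iff)
    moreover have "a \<in> {0, 1, 2, 3, 4, 5}" "b \<in> {0, 1, 2, 3, 4, 5}"
      using 4 ab(1,2) ivl(4) by (metis of_nat_numeral)+
    moreover have "\<not> (even a \<and> even b)" "\<not> (3 dvd a \<and> 3 dvd b)" using 4 no2 no3 by simp_all
    ultimately show ?thesis using ab(3) by blast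
  qed
  then show "e \<subseteq> verts ?G \<and> f ` e \<in> edges fan" using ab V e by simp
qed

theorem proposition3p2p5:
  fixes n :: nat
  assumes "n \<ge> 2"
  shows "(connected_graph (zmod_generating_graph n) \<and>
          (\<not> prime n \<longrightarrow> diameter_of_graph (zmod_generating_graph n) = 2) \<and>
          (prime n \<longrightarrow> diameter_of_graph (zmod_generating_graph n) = 1)) \<and>
         (regular_graph (zmod_generating_graph n) \<longleftrightarrow> prime n) \<and>
         (bipartite_graph (zmod_generating_graph n) \<longleftrightarrow> n = 2) \<and>
         (n > 2 \<longrightarrow> hamiltonian_graph (zmod_generating_graph n)) \<and>
         (eulerian_graph (zmod_generating_graph n) \<longleftrightarrow> odd n) \<and>
         (planar_graph (zmod_generating_graph n) \<longleftrightarrow> n \<in> {2, 3, 4, 6}) \<and>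
         (chromatic_number (zmod_generating_graph n) = totient n + prime_omega n \<and>
          clique_number (zmod_generating_graph n) = totient n + prime_omega n) \<and>
         independence_number (zmod_generating_graph n) = n div Min (prime_factors n)"
proof -
  let ?G = "zmod_generating_graph n"
  have "connected_graph ?G"
    using connected_if_universal_vertex[OF zmod_one_universal[OF assms]] by blast
  moreover have "planar_graph ?G \<longleftrightarrow> n \<in> {2, 3, 4, 6}"
    using zmod_clique_5[OF assms] clique_5_not_planar planar_zmod by metis
  ultimately show ?thesis
    using diameter_zmod[OF assms] regular_zmod_iff[OF assms] bipartite_zmod_iff[OF assms]
      hamiltonian_zmod[of n] eulerian_zmod_iff[OF assms]
      chromatic_and_clique_number_zmod[OF assms] independence_number_zmod[OF assms]
    by blast
qed

end
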